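(* Let $\varphi$ be an $H$-flow on $M$. The Gurevic entropy coincides with the chord entropy: $$h_{\mathrm{Gur}}(\varphi)=h_{\mathcal C}(\varphi).$$ Moreover, for every fixed compact set $K\subset M$ with nonempty interior, there exists $\alpha_0>0$ such that for all $x,y\in K$, $\tau\ge5\tau_K$, $0<\delta<\alpha_0/2$ and $0<\eta<\alpha_0/2$, the quantity $$\frac1T\log\mathcal N_{\mathcal C}(x,y,\eta,T,T+\tau,\delta)$$ converges to $h_{\mathrm{Gur}}(\varphi)$ when $T\to+\infty$; thus $$h_{\mathcal C}(\varphi)=h_{\mathrm{Gur}}(\varphi)=\lim_{T\to\infty}\frac1T\log\mathcal N_{\mathcal C}(x,y,\eta,T,T+\tau,\delta).$$
   Context: **Setting.** $(M,g)$ is a complete connected (not necessarily compact) Riemannian manifold with associated distance $d$; $B(x,r)$ is the open ball. **$H$-flow.** An $H$-flow is a $C^1$ flow $(\varphi_t)_{t\in\mathbb R}$ on a complete Riemannian manifold such that: (1) there is a constant $lip(\varphi)$ with $d(\varphi_\tau(x),\varphi_\tau(y))\le lip(\varphi)\,d(x,y)$ for all $x,y\in M$, $\tau\in[-1,1]$; (2) there exist $0<a\le b$ such that for every $x\in M$ there is $\rho>0$ with $a|t|\le d(x,\varphi_t(x))\le b|t|$ for all $t\in[-\rho,\rho]$; (3) (transitivity) for all nonempty open $U,V\subset M$ and every $T>0$ there is $t\ge T$ with $\varphi_t(U)\cap V\ne\emptyset$; (4) (finite exact shadowing) for every compact $K\subset M$, $\delta>0$ and integer $N\ge1$ there is $\eta>0$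 such that, for all $x_1,\dots,x_N\in K$ and $t_1,\dots,t_N\ge 0$ with $d(\varphi_{t_i}(x_i),x_{i+1})<\eta$ for $1\le i\le N-1$, there is $y\in M$ with $d(\varphi_{s+\sum_{j=1}^{i-1}t_j}(y),\varphi_s(x_i))<\delta$ for all $1\le i\le N$ and $0\le s\le t_i$; (5) (closing lemma) for every $\epsilon>0$ and $x\in M$ there exist $\delta>0$ and $T_{\min}>0$ such that for every $y\in B(x,\epsilon)$ and $t\ge T_{\min}$ with $d(\varphi_t(y),y)\le\delta$ there exist $z\in B(y,\epsilon)$ and $\tau\in[t-\epsilon,t+\epsilon]$ with $\varphi_\tau(z)=z$ and $d(\varphi_s(z),\varphi_s(y))\le\epsilon$ for all $0\le s\le t$; (6) (expansivity) for every $\nu>0$ there is $\epsilon>0$ such that, for all $x,y\in M$, if there is a continuous map $s:\mathbb R\to\mathbb R$ with $s(0)=0$ and $d(\varphi_t(x),\varphi_{s(t)}(y))\le\epsilon$ for all $t\in\mathbb R$, then $y=\varphi_\tau(x)$ for some $\tau\in[-\nu,\nu]$. **Gurevic entropy.** A periodic orbit $\gamma$ is a pair $(\{\varphi_t(x):t\in\mathbb R\},T)$ with $T>0$, $\varphi_T(x)=x$; its period is $\ell(\gamma)=T$ (so multiples of an orbit count as distinct periodic orbits). For $K\subset M$ compact, $\mathcal P_K(T_0,T_1)$ is the set of periodic orbits $\gamma$ with $\ell(\gamma)\in[T_0,T_1]$ and $\gamma\cap K\neq\emptyset$. $h_{\mathrm{Gur}}(\varphi)=\limsup_{L\to\infty}\frac1L\log\#\mathcal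 P_K(L,L+\sigma)$ for any compact $K$ with nonempty interior and any $\sigma>0$ (it does not depend on $K,\sigma$). $\tau_K$ is the minimal period of a periodic orbit (possibly multiply covered) with period $\ge1$ intersecting $K$. **Chords.** $B(z,\delta,T)=\{y:d(\varphi_t(z),\varphi_t(y))<\delta\ \forall t\in[0,T]\}$ is the dynamical ball. For $x,y\in M$, $\eta>0$, $0<T^-<T^+$, $\mathcal C(x,y,\eta,T^-,T^+)=\{z\in B(x,\eta):\varphi_{[T^-,T^+]}(z)\cap B(y,\eta)\ne\emptyset\}$. A set $E$ is $(\delta,T)$-separating if for all distinct $p,q\in E$ there is $t\in[0,T]$ with $d(\varphi_t(p),\varphi_t(q))\ge\delta$. An $E(x,y,\eta,T^-,T^+,\delta)$-set is a $(\delta,T^-)$-separating set $E\subset\mathcal C(x,y,\eta,T^-,T^+)$ such that $\mathcal C(x,y,\eta,T^-,T^+)\subset\bigcup_{z\in E}B(z,\delta,T^-)$. $\mathcal N_{\mathcal C}(x,y,\eta,T^-,T^+,\delta)$ is the maximal cardinality of an $E(x,y,\eta,T^-,T^+,\delta)$-set. **Chord entropy.** $h_{\mathcal C}(\varphi)=\lim_{\delta\to0}\lim_{\eta\to0}\limsup_{T\to\infty}\frac1T\log\mathcal N_{\mathcal C}(x,y,\eta,T,T+\sigma,\delta)$, which does not depend on the choice of $x,y\in M$ and $\sigma>0$. *)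

theory Defs
  imports "HOL-Analysis.Analysis"
begin

section \<open>Riemannian manifolds and their distance\<close>

text \<open>\<open>Ck_on k S f\<close>: \<open>f\<close> is of class \<open>C\<^sup>k\<close> on the open set \<open>S\<close>. Iterating directional
  derivatives keeps the type fixed; since the domain is finite-dimensional, continuity of all
  directional derivatives is continuity of the derivative.\<close>

fun Ck_on :: "nat \<Rightarrow> 'b::euclidean_space set \<Rightarrow> ('b \<Rightarrow> 'c::real_normed_vector) \<Rightarrow> bool" where
  "Ck_on 0 S f \<longleftrightarrow> continuous_on S f"
| "Ck_on (Suc k) S f \<longleftrightarrow>
     (\<forall>x\<in>S. f differentiable (at x)) \<and> (\<forall>v. Ck_on k S (\<lambda>x. frechet_derivative f (at x) v))"

definition smooth_on :: "'b::euclidean_space set \<Rightarrow> ('b \<Rightarrow> 'c::real_normed_vector) \<Rightarrow> bool" where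
  "smooth_on S f \<longleftrightarrow> (\<forall>k. Ck_on k S f)"

text \<open>A chart is a pair of its domain and its coordinate map; the values of the coordinate map
  outside the domain are irrelevant. A Riemannian metric assigns to a chart \<open>c\<close> and a point \<open>p\<close> of
  its domain the inner product on the tangent space at \<open>p\<close>, written in the coordinates of \<open>c\<close>.\<close>

type_synonym ('a, 'e) chart = "'a set \<times> ('a \<Rightarrow> 'e)"
type_synonym ('a, 'e) metric_tensor = "('a, 'e) chart \<Rightarrow> 'a \<Rightarrow> 'e \<Rightarrow> 'e \<Rightarrow> real"

definition smooth_atlas ::
  "('a::topological_space, 'e::euclidean_space) chart set \<Rightarrow> bool" where
  "smooth_atlas \<A> \<longleftrightarrow>
     (\<Union>(U, \<kappa>)\<in>\<A>. U) = UNIV \<and>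
     (\<forall>(U, \<kappa>)\<in>\<A>. open U \<and> open (\<kappa> ` U) \<and> homeomorphism U (\<kappa> ` U) \<kappa> (inv_into U \<kappa>)) \<and>
     (\<forall>(U, \<kappa>)\<in>\<A>. \<forall>(V, \<kappa>')\<in>\<A>. smooth_on (\<kappa> ` (U \<inter> V)) (\<kappa>' \<circ> inv_into U \<kappa>))"

definition riemannian_metric ::
  "('a::topological_space, 'e::euclidean_space) chart set \<Rightarrow> ('a, 'e) metric_tensor \<Rightarrow> bool" where
  "riemannian_metric \<A> g \<longleftrightarrow>
     (\<forall>(U, \<kappa>)\<in>\<A>. \<forall>p\<in>U.
        bilinear (g (U, \<kappa>) p) \<and>
        (\<forall>v w. g (U, \<kappa>) p v w = g (U, \<kappa>) p w v) \<and>
        (\<forall>v. v \<noteq> 0 \<longrightarrow> g (U, \<kappa>) p v v > 0)) \<and>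
     (\<forall>(U, \<kappa>)\<in>\<A>. \<forall>v w. smooth_on (\<kappa> ` U) (\<lambda>u. g (U, \<kappa>) (inv_into U \<kappa> u) v w)) \<and>
     (\<forall>(U, \<kappa>)\<in>\<A>. \<forall>(V, \<kappa>')\<in>\<A>. \<forall>p\<in>U \<inter> V. \<forall>v w.
        g (U, \<kappa>) p v w =
        g (V, \<kappa>') p (frechet_derivative (\<kappa>' \<circ> inv_into U \<kappa>) (at (\<kappa> p)) v)
                   (frechet_derivative (\<kappa>' \<circ> inv_into U \<kappa>) (at (\<kappa> p)) w))"

definition C1_curve_on ::
  "('a::topological_space, 'e::euclidean_space) chart set \<Rightarrow> real \<Rightarrow> real \<Rightarrow> (real \<Rightarrow> 'a) \<Rightarrow> bool" where
  "C1_curve_on \<A> a b \<gamma> \<longleftrightarrow>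
     continuous_on {a..b} \<gamma> \<and>
     (\<forall>(U, \<kappa>)\<in>\<A>.
        (\<forall>t\<in>{a..b}. \<gamma> t \<in> U \<longrightarrow> (\<kappa> \<circ> \<gamma>) differentiable (at t within {a..b})) \<and>
        continuous_on {t\<in>{a..b}. \<gamma> t \<in> U} (\<lambda>t. vector_derivative (\<kappa> \<circ> \<gamma>) (at t within {a..b})))"

definition piecewise_C1_curve ::
  "('a::topological_space, 'e::euclidean_space) chart set \<Rightarrow> (real \<Rightarrow> 'a) \<Rightarrow> bool" where
  "piecewise_C1_curve \<A> \<gamma> \<longleftrightarrow>
     (\<exists>(n::nat) (s::nat \<Rightarrow> real). s 0 = 0 \<and> s n = 1 \<and>
        (\<forall>i<n. s i < s (Suc i) \<and> C1_curve_on \<A> (s i) (s (Suc i)) \<gamma>))"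

text \<open>The speed does not depend on the chosen chart, because \<open>g\<close> is compatible with coordinate
  changes. It is unspecified at the finitely many break points, which do not affect the length.\<close>

definition speed ::
  "('a::topological_space, 'e::euclidean_space) chart set \<Rightarrow> ('a, 'e) metric_tensor \<Rightarrow>
     (real \<Rightarrow> 'a) \<Rightarrow> real \<Rightarrow> real" where
  "speed \<A> g \<gamma> t =
     (let c = (SOME c. c \<in> \<A> \<and> \<gamma> t \<in> fst c);
          v = vector_derivative (snd c \<circ> \<gamma>) (at t)
      in sqrt (g c (\<gamma> t) v v))"

definition curve_length ::
  "('a::topological_space, 'e::euclidean_space) chart set \<Rightarrow> ('a, 'e) metric_tensor \<Rightarrow>
     (real \<Rightarrow> 'a) \<Rightarrow> real" where
  "curve_length \<A> g \<gamma> = integral {0..1} (speed \<A> g \<gamma>)"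

text \<open>A connected Riemannian manifold together with its associated distance: the type-class distance
  is required to be the infimum of the lengths of connecting curves. A connected locally Euclidean
  metric space is second countable, so this need not be demanded separately.\<close>

definition connected_riemannian_manifold ::
  "('a::metric_space, 'e::euclidean_space) chart set \<Rightarrow> ('a, 'e) metric_tensor \<Rightarrow> bool" where
  "connected_riemannian_manifold \<A> g \<longleftrightarrow>
     connected (UNIV :: 'a set) \<and> smooth_atlas \<A> \<and> riemannian_metric \<A> g \<and>
     (\<forall>x y. dist x y =
        Inf {curve_length \<A> g \<gamma> | \<gamma>. piecewise_C1_curve \<A> \<gamma> \<and> \<gamma> 0 = x \<and> \<gamma> 1 = y})"

section \<open>H-flows\<close>

definition C1_flow ::
  "('a::topological_space, 'e::euclidean_space) chart set \<Rightarrow> (real \<Rightarrow> 'a \<Rightarrow> 'a) \<Rightarrow> bool" where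
  "C1_flow \<A> \<phi> \<longleftrightarrow>
     (\<forall>x. \<phi> 0 x = x) \<and> (\<forall>s t x. \<phi> (s + t) x = \<phi> s (\<phi> t x)) \<and>
     continuous_on UNIV (\<lambda>(t, x). \<phi> t x) \<and>
     (\<forall>(U, \<kappa>)\<in>\<A>. \<forall>(V, \<kappa>')\<in>\<A>.
        Ck_on 1 {(t, u). u \<in> \<kappa> ` U \<and> \<phi> t (inv_into U \<kappa> u) \<in> V}
          (\<lambda>(t, u). \<kappa>' (\<phi> t (inv_into U \<kappa> u))))"

definition time_lipschitz :: "(real \<Rightarrow> 'a::metric_space \<Rightarrow> 'a) \<Rightarrow> bool" where
  "time_lipschitz \<phi> \<longleftrightarrow>
     (\<exists>lip. \<forall>x y. \<forall>\<tau>\<in>{-1..1}. dist (\<phi> \<tau> x) (\<phi> \<tau> y) \<le> lip * dist x y)"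

definition bounded_displacement :: "(real \<Rightarrow> 'a::metric_space \<Rightarrow> 'a) \<Rightarrow> bool" where
  "bounded_displacement \<phi> \<longleftrightarrow>
     (\<exists>a b. 0 < a \<and> a \<le> b \<and>
        (\<forall>x. \<exists>\<rho>>0. \<forall>t\<in>{-\<rho>..\<rho>}. a * \<bar>t\<bar> \<le> dist x (\<phi> t x) \<and> dist x (\<phi> t x) \<le> b * \<bar>t\<bar>))"

definition transitive_flow :: "(real \<Rightarrow> 'a::metric_space \<Rightarrow> 'a) \<Rightarrow> bool" where
  "transitive_flow \<phi> \<longleftrightarrow>
     (\<forall>U V. open U \<and> U \<noteq> {} \<and> open V \<and> V \<noteq> {} \<longrightarrow>
        (\<forall>T>0. \<exists>t\<ge>T. \<phi> t ` U \<inter> V \<noteq> {}))"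

definition finite_exact_shadowing :: "(real \<Rightarrow> 'a::metric_space \<Rightarrow> 'a) \<Rightarrow> bool" where
  "finite_exact_shadowing \<phi> \<longleftrightarrow>
     (\<forall>K. compact K \<longrightarrow> (\<forall>\<delta>>0. \<forall>N::nat. N \<ge> 1 \<longrightarrow>
        (\<exists>\<eta>>0. \<forall>(x::nat \<Rightarrow> 'a) (t::nat \<Rightarrow> real).
           (\<forall>i\<in>{1..N}. x i \<in> K \<and> t i \<ge> 0) \<and>
           (\<forall>i. 1 \<le> i \<and> i < N \<longrightarrow> dist (\<phi> (t i) (x i)) (x (Suc i)) < \<eta>) \<longrightarrow>
           (\<exists>y. \<forall>i\<in>{1..N}. \<forall>s\<in>{0..t i}.
              dist (\<phi> (s + (\<Sum>j=1..<i. t j)) y) (\<phi> s (x i)) < \<delta>))))"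

definition closing_lemma :: "(real \<Rightarrow> 'a::metric_space \<Rightarrow> 'a) \<Rightarrow> bool" where
  "closing_lemma \<phi> \<longleftrightarrow>
     (\<forall>\<epsilon>>0. \<forall>x. \<exists>\<delta>>0. \<exists>Tmin>0. \<forall>y\<in>ball x \<epsilon>. \<forall>t\<ge>Tmin. dist (\<phi> t y) y \<le> \<delta> \<longrightarrow>
        (\<exists>z\<in>ball y \<epsilon>. \<exists>\<tau>\<in>{t - \<epsilon>..t + \<epsilon>}.
           \<phi> \<tau> z = z \<and> (\<forall>s\<in>{0..t}. dist (\<phi> s z) (\<phi> s y) \<le> \<epsilon>)))"

definition expansive_flow :: "(real \<Rightarrow> 'a::metric_space \<Rightarrow> 'a) \<Rightarrow> bool" where
  "expansive_flow \<phi> \<longleftrightarrow>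
     (\<forall>\<nu>>0. \<exists>\<epsilon>>0. \<forall>x y.
        (\<exists>s::real \<Rightarrow> real. continuous_on UNIV s \<and> s 0 = 0 \<and>
           (\<forall>t. dist (\<phi> t x) (\<phi> (s t) y) \<le> \<epsilon>)) \<longrightarrow>
        (\<exists>\<tau>\<in>{-\<nu>..\<nu>}. y = \<phi> \<tau> x))"

definition H_flow ::
  "('a::metric_space, 'e::euclidean_space) chart set \<Rightarrow> (real \<Rightarrow> 'a \<Rightarrow> 'a) \<Rightarrow> bool" where
  "H_flow \<A> \<phi> \<longleftrightarrow>
     C1_flow \<A> \<phi> \<and> time_lipschitz \<phi> \<and> bounded_displacement \<phi> \<and> transitive_flow \<phi> \<and>
     finite_exact_shadowing \<phi> \<and> closing_lemma \<phi> \<and> expansive_flow \<phi>"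

section \<open>Counting with values in the extended naturals\<close>

definition ecard :: "'b set \<Rightarrow> enat" where
  "ecard A = (if finite A then enat (card A) else \<infinity>)"

text \<open>Natural logarithm with \<open>log 0 = -\<infinity>\<close> and \<open>log \<infinity> = \<infinity>\<close>.\<close>

definition elog :: "enat \<Rightarrow> ereal" where
  "elog n = (case n of enat k \<Rightarrow> (if k = 0 then -\<infinity> else ereal (ln (real k))) | \<infinity> \<Rightarrow> \<infinity>)"

section \<open>Gurevic entropy\<close>

text \<open>An orbit together with a (not necessarily minimal) period.\<close>

definition periodic_orbits :: "(real \<Rightarrow> 'a \<Rightarrow> 'a) \<Rightarrow> ('a set \<times> real) set" where
  "periodic_orbits \<phi> = {(range (\<lambda>t. \<phi> t x), T) | x T. T > 0 \<and> \<phi> T x = x}"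

definition periodic_orbits_between ::
  "(real \<Rightarrow> 'a \<Rightarrow> 'a) \<Rightarrow> 'a set \<Rightarrow> real \<Rightarrow> real \<Rightarrow> ('a set \<times> real) set" where
  "periodic_orbits_between \<phi> K T0 T1 =
     {(\<gamma>, T). (\<gamma>, T) \<in> periodic_orbits \<phi> \<and> T \<in> {T0..T1} \<and> \<gamma> \<inter> K \<noteq> {}}"

definition gurevic_entropy :: "(real \<Rightarrow> 'a \<Rightarrow> 'a) \<Rightarrow> 'a set \<Rightarrow> real \<Rightarrow> ereal" where
  "gurevic_entropy \<phi> K \<sigma> =
     Limsup at_top (\<lambda>L::real. elog (ecard (periodic_orbits_between \<phi> K L (L + \<sigma>))) / ereal L)"

definition min_period :: "(real \<Rightarrow> 'a \<Rightarrow> 'a) \<Rightarrow> 'a set \<Rightarrow> real" where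
  "min_period \<phi> K = Inf {T. T \<ge> 1 \<and> (\<exists>\<gamma>. (\<gamma>, T) \<in> periodic_orbits \<phi> \<and> \<gamma> \<inter> K \<noteq> {})}"

section \<open>Chord entropy\<close>

definition dyn_ball ::
  "(real \<Rightarrow> 'a::metric_space \<Rightarrow> 'a) \<Rightarrow> 'a \<Rightarrow> real \<Rightarrow> real \<Rightarrow> 'a set" where
  "dyn_ball \<phi> z \<delta> T = {y. \<forall>t\<in>{0..T}. dist (\<phi> t z) (\<phi> t y) < \<delta>}"

definition chords ::
  "(real \<Rightarrow> 'a::metric_space \<Rightarrow> 'a) \<Rightarrow> 'a \<Rightarrow> 'a \<Rightarrow> real \<Rightarrow> real \<Rightarrow> real \<Rightarrow> 'a set" where
  "chords \<phi> x y \<eta> T0 T1 = {z \<in> ball x \<eta>. (\<lambda>t. \<phi> t z) ` {T0..T1} \<inter> ball y \<eta> \<noteq> {}}"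

definition separating ::
  "(real \<Rightarrow> 'a::metric_space \<Rightarrow> 'a) \<Rightarrow> real \<Rightarrow> real \<Rightarrow> 'a set \<Rightarrow> bool" where
  "separating \<phi> \<delta> T E \<longleftrightarrow>
     (\<forall>p\<in>E. \<forall>q\<in>E. p \<noteq> q \<longrightarrow> (\<exists>t\<in>{0..T}. dist (\<phi> t p) (\<phi> t q) \<ge> \<delta>))"

definition E_set ::
  "(real \<Rightarrow> 'a::metric_space \<Rightarrow> 'a) \<Rightarrow> 'a \<Rightarrow> 'a \<Rightarrow> real \<Rightarrow> real \<Rightarrow> real \<Rightarrow> real \<Rightarrow> 'a set \<Rightarrow> bool" where
  "E_set \<phi> x y \<eta> T0 T1 \<delta> E \<longleftrightarrow>
     E \<subseteq> chords \<phi> x y \<eta> T0 T1 \<and> separating \<phi> \<delta> T0 E \<and>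
     chords \<phi> x y \<eta> T0 T1 \<subseteq> (\<Union>z\<in>E. dyn_ball \<phi> z \<delta> T0)"

text \<open>The supremum in \<open>enat\<close> is attained, hence is the maximal cardinality.\<close>

definition chord_number ::
  "(real \<Rightarrow> 'a::metric_space \<Rightarrow> 'a) \<Rightarrow> 'a \<Rightarrow> 'a \<Rightarrow> real \<Rightarrow> real \<Rightarrow> real \<Rightarrow> real \<Rightarrow> enat" where
  "chord_number \<phi> x y \<eta> T0 T1 \<delta> = Sup {ecard E | E. E_set \<phi> x y \<eta> T0 T1 \<delta> E}"

text \<open>Both limits exist in \<open>ereal\<close>, because the chord number is monotone in \<open>\<eta>\<close> and antimonotone
  in \<open>\<delta>\<close>.\<close>

definition chord_entropy ::
  "(real \<Rightarrow> 'a::metric_space \<Rightarrow> 'a) \<Rightarrow> 'a \<Rightarrow> 'a \<Rightarrow> real \<Rightarrow> ereal" where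
  "chord_entropy \<phi> x y \<sigma> =
     Lim (at_right 0) (\<lambda>\<delta>. Lim (at_right 0) (\<lambda>\<eta>.
       Limsup at_top (\<lambda>T. elog (chord_number \<phi> x y \<eta> T (T + \<sigma>) \<delta>) / ereal T)))"

end

theory Submission
  imports Defs "HOL-Real_Asymp.Real_Asymp"
begin

text \<open>
  Every comparison rests on one construction: orbit segments with ends in a compact set are joined by
  connecting orbits, which exist by transitivity, and the resulting pseudo-orbit is shadowed by a true
  orbit. Covering the compact set by finitely many small balls, only finitely many connecting orbits
  are needed, so that this changes lengths and cardinalities by bounded amounts only. A family of
  segments is called separated if any two of them are at some time at distance at least \<open>\<delta>\<close>.

  \<^emph>\<open>Chords give periodic orbits\<close> (\<open>glue_two_families\<close>). A chord, or a pair of segments, is closed up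
  by a connecting orbit through the interior of \<open>K\<close>, and the closing lemma turns the shadowing orbit
  into a periodic one. Two families of segments with lengths near \<open>L1\<close> and \<open>L2\<close> thus produce
  periodic orbits with period near \<open>L1 + L2\<close>. The periodic orbit with a position on it, up to a small
  error, determines the segments, so that the number of pairs giving the same orbit grows at most
  linearly in \<open>L1 + L2\<close>.

  \<^emph>\<open>Periodic orbits give chords\<close>. By expansivity, periodic orbits through a compact set with periods in
  a short window are separated at a scale depending on the flow only (\<open>periodic_orbits_separated\<close>).
  Connecting \<open>x\<close> to the orbit and the orbit to \<open>y\<close> yields equally many separated chords
  (\<open>segments_to_chords\<close>). As linear factors and bounded shifts of the length do not affect exponential
  growth rates (\<open>Limsup_elog_le\<close>), the upper growth rate of the number of chords is the Gurevic entropy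
  for all small \<open>\<delta>\<close> and \<open>\<eta>\<close>; this shows the equality of the entropies and their independence of all
  choices.

  \<^emph>\<open>The limit exists\<close>. Glued to each other, periodic orbits show that their number is supermultiplicative
  up to a linear factor and a bounded shift of the length (\<open>orbit_count_supermultiplicative\<close>). The
  shadowing constants depend on the number of pieces, so many orbits cannot be glued at once; gluing
  in pairs along a balanced binary tree keeps the accumulated losses geometric
  (\<open>supermultiplicative_iterate\<close>), and one period length with many orbits forces the same growth along a
  sequence of lengths with bounded gaps. Finally, the chords may run \<open>j\<close> times along a fixed periodic
  orbit through \<open>K\<close> before they reach \<open>y\<close>. This counts as a single piece, and it adjusts the length
  up to one period of that orbit, which is why the hitting window has to be longer than that
  period. Hence the lower growth rate is also the Gurevic entropy.
\<close>

section \<open>Locally compact H-flows\<close>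

text \<open>The dynamical axioms of an H-flow on a locally compact metric space. Local compactness supplies
  the compact sets to which the shadowing property and the covering arguments are applied.\<close>

locale locally_compact_H_flow =
  fixes \<phi> :: "real \<Rightarrow> 'a::metric_space \<Rightarrow> 'a"
  assumes flow_zero [simp]: "\<phi> 0 x = x"
    and flow_add: "\<phi> (s + t) x = \<phi> s (\<phi> t x)"
    and time_lipschitz: "time_lipschitz \<phi>"
    and bounded_displacement: "bounded_displacement \<phi>"
    and transitive: "transitive_flow \<phi>"
    and shadowing: "finite_exact_shadowing \<phi>"
    and closing: "closing_lemma \<phi>"
    and expansive: "expansive_flow \<phi>"
    and locally_compact: "\<exists>C. compact C \<and> x \<in> interior C"

lemma smooth_atlas_imp_locally_compact:
  fixes \<A> :: "('a::metric_space, 'e::euclidean_space) chart set"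
  assumes "smooth_atlas \<A>"
  shows "\<exists>C. compact C \<and> (x::'a) \<in> interior C"
proof -
  have "x \<in> (\<Union>(U, \<kappa>)\<in>\<A>. U)"
    using assms by (simp add: smooth_atlas_def)
  then obtain U \<kappa> where c: "(U, \<kappa>) \<in> \<A>" "x \<in> U"
    by auto
  with assms have U: "open U" "open (\<kappa> ` U)"
    and hom: "homeomorphism U (\<kappa> ` U) \<kappa> (inv_into U \<kappa>)"
    unfolding smooth_atlas_def by auto
  obtain e where e: "e > 0" "cball (\<kappa> x) e \<subseteq> \<kappa> ` U"
    using U c open_contains_cball by (metis imageI)
  let ?C = "inv_into U \<kappa> ` cball (\<kappa> x) e"
  have "compact ?C"
    using hom e by (intro compact_continuous_image)
      (auto simp: homeomorphism_def elim: continuous_on_subset)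
  moreover have "x \<in> interior ?C"
  proof (rule interiorI)
    show "open (U \<inter> \<kappa> -` ball (\<kappa> x) e)"
      using hom U by (intro continuous_open_preimage) (auto simp: homeomorphism_def)
    show "x \<in> U \<inter> \<kappa> -` ball (\<kappa> x) e"
      using c e by auto
    show "U \<inter> \<kappa> -` ball (\<kappa> x) e \<subseteq> ?C"
    proof
      fix y assume y: "y \<in> U \<inter> \<kappa> -` ball (\<kappa> x) e"
      then have "y = inv_into U \<kappa> (\<kappa> y)"
        using hom by (auto simp: homeomorphism_def)
      moreover have "\<kappa> y \<in> cball (\<kappa> x) e"
        using y by auto
      ultimately show "y \<in> ?C"
        by blast
    qed
  qed
  ultimately show ?thesis
    by blast
qed

lemma H_flow_imp_locally_compact_H_flow:
  assumes "connected_riemannian_manifold \<A> g" "H_flow \<A> \<phi>"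
  shows "locally_compact_H_flow \<phi>"
proof -
  have "C1_flow \<A> \<phi>" "smooth_atlas \<A>"
    using assms unfolding H_flow_def connected_riemannian_manifold_def by auto
  then show ?thesis
    using assms(2) smooth_atlas_imp_locally_compact[of \<A>]
    unfolding H_flow_def C1_flow_def by unfold_locales auto
qed

section \<open>Auxiliary facts on compact sets and on finite sets\<close>

lemma dist_triangle_three:
  fixes p q r s :: "'a::metric_space"
  shows "dist p s \<le> dist p q + dist q r + dist r s"
  using dist_triangle[of p s q] dist_triangle[of q s r] by linarith

text \<open>A property that holds near every point with some constant, and persists for smaller constants,
  holds on a compact set with one constant.\<close>

lemma compact_uniform_constant:
  fixes Q :: "real \<Rightarrow> 'a::topological_space \<Rightarrow> bool"
  assumes "compact K"
    and local: "\<And>p. p \<in> K \<Longrightarrow> \<exists>U e. open U \<and> p \<in> U \<and> e > 0 \<and> (\<forall>q\<in>U. Q e q)"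
    and anti: "\<And>e e' q. Q e q \<Longrightarrow> 0 < e' \<Longrightarrow> e' \<le> e \<Longrightarrow> Q e' q"
  shows "\<exists>e>0. \<forall>q\<in>K. Q e q"
proof -
  have "\<forall>p\<in>K. \<exists>Ue. open (fst Ue) \<and> p \<in> fst Ue \<and> snd Ue > 0 \<and> (\<forall>q\<in>fst Ue. Q (snd Ue) q)"
    using local by simp
  from bchoice[OF this] obtain V where
    V: "\<forall>p\<in>K. open (fst (V p)) \<and> p \<in> fst (V p) \<and> snd (V p) > 0 \<and> (\<forall>q\<in>fst (V p). Q (snd (V p)) q)"
    by (elim exE)
  define U e where "U p = fst (V p)" and "e p = snd (V p)" for p
  have Ue: "\<And>p. p \<in> K \<Longrightarrow> open (U p) \<and> p \<in> U p \<and> e p > 0 \<and> (\<forall>q\<in>U p. Q (e p) q)"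
    using V by (simp add: U_def e_def)
  obtain F where F: "F \<subseteq> K" "finite F" "K \<subseteq> (\<Union>p\<in>F. U p)"
  proof (rule compactE_image[OF \<open>compact K\<close>, of K U])
    show "open (U p)" if "p \<in> K" for p
      using Ue that by blast
    show "K \<subseteq> (\<Union>p\<in>K. U p)"
      using Ue by blast
  qed
  let ?e = "Min (insert 1 (e ` F))"
  have "?e > 0"
    using F Ue by (subst Min_gr_iff) auto
  moreover have "Q ?e q" if q: "q \<in> K" for q
  proof -
    obtain p where p: "p \<in> F" "q \<in> U p"
      using F q by blast
    then have "Q (e p) q"
      using Ue F by blast
    moreover have "?e \<le> e p"
      using p F by (intro Min_le) auto
    ultimately show ?thesis
      using anti \<open>?e > 0\<close> by blast
  qed
  ultimately show ?thesis
    by blast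
qed

lemma compact_finite_net:
  fixes K :: "'a::metric_space set"
  assumes "compact K" "e > 0"
  shows "\<exists>F. finite F \<and> F \<subseteq> K \<and> (\<forall>p\<in>K. \<exists>q\<in>F. dist p q < e)"
proof -
  obtain F where "finite F" "F \<subseteq> K" "K \<subseteq> (\<Union>x\<in>F. ball x e)"
    using seq_compact_imp_totally_bounded[of K] assms compact_imp_seq_compact by metis
  then show ?thesis
    by (intro exI[of _ F]) (auto simp: dist_commute subset_iff)
qed

text \<open>A subset of a compact set whose points have mutual distance at least \<open>e\<close> has a bounded number
  of elements.\<close>

lemma compact_uniformly_discrete_card:
  fixes K :: "'a::metric_space set"
  assumes "compact K" "e > 0"
  shows "\<exists>n::nat. \<forall>W\<subseteq>K. (\<forall>p\<in>W. \<forall>q\<in>W. p \<noteq> q \<longrightarrow> dist p q \<ge> e) \<longrightarrow> finite W \<and> card W \<le> n"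
proof -
  obtain F where F: "finite F" "\<And>p. p \<in> K \<Longrightarrow> \<exists>q\<in>F. dist p q < e/2"
    using compact_finite_net[OF assms(1), of "e/2"] assms(2) by auto
  then obtain f where f: "\<And>p. p \<in> K \<Longrightarrow> f p \<in> F \<and> dist p (f p) < e/2"
    by metis
  have "finite W \<and> card W \<le> card F"
    if W: "W \<subseteq> K" "\<forall>p\<in>W. \<forall>q\<in>W. p \<noteq> q \<longrightarrow> dist p q \<ge> e" for W
  proof -
    have "inj_on f W"
    proof (rule inj_onI, rule ccontr)
      fix p q assume pq: "p \<in> W" "q \<in> W" "f p = f q" "p \<noteq> q"
      then have "dist p (f p) < e/2" "dist q (f p) < e/2"
        using f W by fastforce+
      then have "dist p q < e"
        using pq(3) by (metis dist_commute dist_triangle_half_r)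
      then show False
        using W pq by fastforce
    qed
    moreover have "f ` W \<subseteq> F"
      using f W by blast
    ultimately show ?thesis
      using F(1) by (meson card_inj_on_le finite_subset inj_on_finite)
  qed
  then show ?thesis
    by blast
qed

lemma pigeonhole_fibre:
  assumes "finite I" "finite Q" "Q \<noteq> {}" "f ` I \<subseteq> Q"
  shows "\<exists>q\<in>Q. card I \<le> card Q * card {i\<in>I. f i = q}"
proof (rule ccontr)
  assume neg: "\<not> ?thesis"
  have "card I = (\<Sum>q\<in>Q. card {i\<in>I. f i = q})"
    using sum.group[OF assms(1,2,4), of "\<lambda>_. 1::nat"] by simp
  moreover obtain q where q: "q \<in> Q" "\<forall>q'\<in>Q. card {i\<in>I. f i = q'} \<le> card {i\<in>I. f i = q}"
  proof -
    let ?c = "\<lambda>q. card {i\<in>I. f i = q}"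
    have "Max (?c ` Q) \<in> ?c ` Q"
      using assms by (intro Max_in) auto
    then obtain q where "q \<in> Q" "?c q = Max (?c ` Q)"
      by force
    moreover have "?c q' \<le> Max (?c ` Q)" if "q' \<in> Q" for q'
      using that assms by (intro Max_ge) auto
    ultimately show ?thesis
      using that by auto
  qed
  ultimately have "card I \<le> card Q * card {i\<in>I. f i = q}"
    using sum_bounded_above[of Q "\<lambda>q. card {i\<in>I. f i = q}"] by simp
  then show False
    using neg q by blast
qed

lemma compact_neighbourhood:
  fixes K :: "'a::metric_space set"
  assumes "compact K" and lc: "\<And>x::'a. \<exists>C. compact C \<and> x \<in> interior C"
  shows "\<exists>r>0. \<exists>K'. compact K' \<and> (\<forall>q\<in>K. ball q r \<subseteq> K')"
proof -
  obtain C where C: "\<And>x::'a. compact (C x) \<and> x \<in> interior (C x)"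
    using lc by metis
  obtain F where F: "F \<subseteq> K" "finite F" "K \<subseteq> (\<Union>x\<in>F. interior (C x))"
  proof (rule compactE_image[OF \<open>compact K\<close>, of K "\<lambda>x. interior (C x)"])
    show "K \<subseteq> (\<Union>x\<in>K. interior (C x))"
      using C by blast
  qed auto
  obtain r where "r > 0" "(\<Union>x\<in>K. ball x r) \<subseteq> (\<Union>x\<in>F. interior (C x))"
    using compact_subset_open_imp_ball_epsilon_subset[OF assms(1) _ F(3)] by blast
  moreover have "compact (\<Union>x\<in>F. C x)"
    using C F by (intro compact_UN) auto
  moreover have "(\<Union>x\<in>F. interior (C x)) \<subseteq> (\<Union>x\<in>F. C x)"
    using interior_subset by blast
  ultimately show ?thesis
    by (metis (no_types, lifting) UN_subset_iff subset_trans)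
qed

section \<open>Elementary estimates for the flow\<close>

context locally_compact_H_flow
begin

lemma flow_inverse [simp]: "\<phi> (-t) (\<phi> t x) = x" "\<phi> t (\<phi> (-t) x) = x"
  using flow_add[of "-t" t x] flow_add[of t "-t" x] by simp_all

text \<open>The upper displacement bound, assumed only for small times, holds for all times.\<close>

lemma displacement:
  "\<exists>b>0. \<forall>t x. dist x (\<phi> t x) \<le> b * \<bar>t\<bar>"
proof -
  obtain a b where ab: "0 < a" "a \<le> b"
    and loc: "\<And>x. \<exists>\<rho>>0. \<forall>t\<in>{-\<rho>..\<rho>}. a * \<bar>t\<bar> \<le> dist x (\<phi> t x) \<and> dist x (\<phi> t x) \<le> b * \<bar>t\<bar>"
    using bounded_displacement unfolding bounded_displacement_def by blast
  have pos: "dist (\<phi> u x) (\<phi> v x) \<le> b * (v - u)" if "u \<le> v" for u v x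
    using that
  proof (induction rule: Bolzano)
    case (trans u v w)
    have "dist (\<phi> u x) (\<phi> w x) \<le> dist (\<phi> u x) (\<phi> v x) + dist (\<phi> v x) (\<phi> w x)"
      by (rule dist_triangle)
    with trans show ?case
      by (simp add: algebra_simps)
  next
    case (local t)
    obtain \<rho> where \<rho>: "\<rho> > 0" "\<And>s. s \<in> {-\<rho>..\<rho>} \<Longrightarrow> dist (\<phi> t x) (\<phi> s (\<phi> t x)) \<le> b * \<bar>s\<bar>"
      using loc[of "\<phi> t x"] by blast
    have "dist (\<phi> u x) (\<phi> v x) \<le> b * (v - u)" if "u \<le> t" "t \<le> v" "v - u < \<rho>" for u v
    proof -
      have "dist (\<phi> t x) (\<phi> u x) \<le> b * (t - u)" "dist (\<phi> t x) (\<phi> v x) \<le> b * (v - t)"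
        using \<rho>(2)[of "u - t"] \<rho>(2)[of "v - t"] that
          flow_add[of "u - t" t x] flow_add[of "v - t" t x] by simp_all
      then show ?thesis
        using dist_triangle3[of "\<phi> u x" "\<phi> v x" "\<phi> t x"] by (simp add: algebra_simps)
    qed
    then show ?case
      using \<rho>(1) by blast
  qed
  have "dist x (\<phi> t x) \<le> b * \<bar>t\<bar>" for t x
    using pos[of 0 t x] pos[of t 0 x] by (cases "t \<ge> 0") (simp_all add: dist_commute)
  then show ?thesis
    using ab by (intro exI[of _ b]) auto
qed

lemma lipschitz_bounded_time:
  "\<exists>\<Lambda>>0. \<forall>t\<in>{0..T}. \<forall>x y. dist (\<phi> t x) (\<phi> t y) \<le> \<Lambda> * dist x y"
proof -
  obtain l where l: "\<And>x y \<tau>. \<tau> \<in> {-1..1} \<Longrightarrow> dist (\<phi> \<tau> x) (\<phi> \<tau> y) \<le> l * dist x y"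
    using time_lipschitz unfolding time_lipschitz_def by blast
  define m where "m = max 1 l"
  have m: "m \<ge> 1" "\<And>x y \<tau>. \<tau> \<in> {-1..1} \<Longrightarrow> dist (\<phi> \<tau> x) (\<phi> \<tau> y) \<le> m * dist x y"
    using l mult_right_mono[of l m] unfolding m_def
    by (auto intro: order_trans[OF l] mult_right_mono)
  have *: "\<forall>t\<in>{0..real n}. \<forall>x y. dist (\<phi> t x) (\<phi> t y) \<le> m ^ n * dist x y" for n
  proof (induction n)
    case (Suc n)
    show ?case
    proof (intro ballI allI)
      fix t x y assume t: "t \<in> {0..real (Suc n)}"
      define s where "s = min t 1"
      have s: "s \<in> {-1..1}" "t - s \<in> {0..real n}"
        using t by (auto simp: s_def min_def)
      have "dist (\<phi> t x) (\<phi> t y) = dist (\<phi> s (\<phi> (t - s) x)) (\<phi> s (\<phi> (t - s) y))"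
        using flow_add[of s "t - s"] by simp
      also have "\<dots> \<le> m * dist (\<phi> (t - s) x) (\<phi> (t - s) y)"
        using m(2) s(1) .
      also have "\<dots> \<le> m * (m ^ n * dist x y)"
        using Suc.IH s(2) m(1) by (intro mult_left_mono) auto
      finally show "dist (\<phi> t x) (\<phi> t y) \<le> m ^ Suc n * dist x y"
        by simp
    qed
  qed simp
  have "{0..T} \<subseteq> {0..real (nat \<lceil>T\<rceil>)}"
    by (auto intro: order_trans[OF _ real_nat_ceiling_ge])
  with * m(1) show ?thesis
    by (intro exI[of _ "m ^ nat \<lceil>T\<rceil>"]) (auto simp: subset_iff)
qed

text \<open>Periodic orbits through a compact set cannot have arbitrarily small periods: a point of period
  \<open>t\<close> moves by at most \<open>b * t\<close>, but no point near a given one is almost fixed by the flow.\<close>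

lemma period_lower_bound:
  assumes "compact K"
  shows "\<exists>w>0. \<forall>p\<in>K. \<forall>t. 0 < t \<and> t \<le> w \<longrightarrow> \<phi> t p \<noteq> p"
proof (rule compact_uniform_constant[OF assms])
  obtain b where b: "b > 0" "\<And>t x. dist x (\<phi> t x) \<le> b * \<bar>t\<bar>"
    using displacement by blast
  fix p assume "p \<in> K"
  \<comment> \<open>The point \<open>p\<close> has moved by \<open>D > 0\<close> at time \<open>\<rho>\<close>, hence nearby points by at least \<open>D / 2\<close>.\<close>
  obtain a \<rho> where a: "0 < a" "\<rho> > 0" "a * \<bar>\<rho>\<bar> \<le> dist p (\<phi> \<rho> p)"
    using bounded_displacement unfolding bounded_displacement_def
    by (meson atLeastAtMost_iff dual_order.refl neg_le_0_iff_le order_le_less order_trans)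
  define D where "D = dist p (\<phi> \<rho> p)"
  have "a * \<rho> > 0" using a by simp
  then have D: "D > 0"
    using a(2,3) unfolding D_def by linarith
  obtain \<Lambda> where \<Lambda>: "\<Lambda> > 0" "\<And>x y. dist (\<phi> \<rho> x) (\<phi> \<rho> y) \<le> \<Lambda> * dist x y"
    using lipschitz_bounded_time[of \<rho>] a(2) by auto
  define r where "r = D / (2 * (1 + \<Lambda>))"
  have r: "r > 0" "(1 + \<Lambda>) * r = D / 2"
    using D \<Lambda>(1) by (auto simp: r_def field_simps)
  have "\<phi> t q \<noteq> q" if q: "q \<in> ball p r" and t: "0 < t" "t \<le> D / (2 * b)" for q t
  proof
    assume per: "\<phi> t q = q"
    have iter: "\<phi> (real n * t) q = q" for n
      by (induction n) (simp_all add: distrib_right flow_add per)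
    define k where "k = nat \<lfloor>\<rho> / t\<rfloor>"
    define u where "u = \<rho> - real k * t"
    have "real k \<le> \<rho> / t" "\<rho> / t < real k + 1"
      using a(2) t(1) by (auto simp: k_def)
    then have u: "0 \<le> u" "u < t"
      using t(1) by (auto simp: u_def field_simps)
    have "\<phi> \<rho> q = \<phi> u q"
      using flow_add[of u "real k * t" q] iter by (simp add: u_def)
    then have "dist q (\<phi> \<rho> q) \<le> b * u"
      using b(2)[of q u] u by simp
    also have "\<dots> < b * t"
      using u b(1) by simp
    also have "\<dots> \<le> D / 2"
      using t b(1) by (simp add: field_simps)
    finally have 1: "dist q (\<phi> \<rho> q) < D / 2" .
    have "D \<le> dist p q + dist q (\<phi> \<rho> q) + dist (\<phi> \<rho> q) (\<phi> \<rho> p)"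
      unfolding D_def by (metis add_right_mono dist_triangle order_trans)
    also have "\<dots> < dist p q + D / 2 + \<Lambda> * dist p q"
      using 1 \<Lambda>(2)[of q p] by (simp add: dist_commute)
    also have "\<dots> = (1 + \<Lambda>) * dist p q + D / 2"
      by (simp add: algebra_simps)
    also have "\<dots> \<le> (1 + \<Lambda>) * r + D / 2"
      using q \<Lambda>(1) by (intro add_right_mono mult_left_mono) auto
    finally show False
      using r by simp
  qed
  then show "\<exists>U e. open U \<and> p \<in> U \<and> e > 0 \<and> (\<forall>q\<in>U. \<forall>t. 0 < t \<and> t \<le> e \<longrightarrow> \<phi> t q \<noteq> q)"
    using r(1) D b(1) by (intro exI[of _ "ball p r"] exI[of _ "D / (2 * b)"]) auto
next
  fix e e' :: real and q
  assume "\<forall>t. 0 < t \<and> t \<le> e \<longrightarrow> \<phi> t q \<noteq> q" "e' \<le> e"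
  then show "\<forall>t. 0 < t \<and> t \<le> e' \<longrightarrow> \<phi> t q \<noteq> q"
    by (meson order_trans)
qed

lemma connecting_segment:
  assumes "\<eta> > 0"
  shows "\<exists>u s. s \<ge> T \<and> dist u p < \<eta> \<and> dist (\<phi> s u) q < \<eta>"
proof -
  have "\<forall>T>0. \<exists>t\<ge>T. \<phi> t ` ball p \<eta> \<inter> ball q \<eta> \<noteq> {}"
    using transitive assms unfolding transitive_flow_def
    by (metis open_ball centre_in_ball empty_iff)
  then obtain t where t: "t \<ge> max 1 T" "\<phi> t ` ball p \<eta> \<inter> ball q \<eta> \<noteq> {}"
    by (meson less_max_iff_disj zero_less_one)
  then obtain u where "u \<in> ball p \<eta>" "\<phi> t u \<in> ball q \<eta>"
    by blast
  with t(1) show ?thesis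
    by (intro exI[of _ u] exI[of _ t]) (auto simp: dist_commute)
qed

text \<open>The constants of the closing lemma depend on the point; on a compact set they can be chosen
  uniformly.\<close>

lemma uniform_closing:
  assumes "compact K" "\<epsilon> > 0"
  obtains d T where "d > 0" "T > 0"
    "\<And>p y t. p \<in> K \<Longrightarrow> dist p y < \<epsilon>/2 \<Longrightarrow> t \<ge> T \<Longrightarrow> dist (\<phi> t y) y \<le> d \<Longrightarrow>
      \<exists>z \<tau>. \<tau> \<in> {t - \<epsilon>..t + \<epsilon>} \<and> \<phi> \<tau> z = z \<and> (\<forall>s\<in>{0..t}. dist (\<phi> s z) (\<phi> s y) \<le> \<epsilon>)"
proof -
  \<comment> \<open>One parameter \<open>e\<close> controls both constants, as \<open>d = e\<close> and \<open>T = 1 / e\<close>.\<close>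
  define Q where "Q e p \<longleftrightarrow> (\<forall>y t. dist p y < \<epsilon>/2 \<and> t \<ge> 1 / e \<and> dist (\<phi> t y) y \<le> e \<longrightarrow>
    (\<exists>z \<tau>. \<tau> \<in> {t - \<epsilon>..t + \<epsilon>} \<and> \<phi> \<tau> z = z \<and> (\<forall>s\<in>{0..t}. dist (\<phi> s z) (\<phi> s y) \<le> \<epsilon>)))" for e p
  have "\<exists>e>0. \<forall>q\<in>K. Q e q"
  proof (rule compact_uniform_constant[OF assms(1)])
    fix p
    have "\<exists>d>0. \<exists>T>0. \<forall>y\<in>ball p \<epsilon>. \<forall>t\<ge>T. dist (\<phi> t y) y \<le> d \<longrightarrow>
        (\<exists>z\<in>ball y \<epsilon>. \<exists>\<tau>\<in>{t - \<epsilon>..t + \<epsilon>}. \<phi> \<tau> z = z \<and> (\<forall>s\<in>{0..t}. dist (\<phi> s z) (\<phi> s y) \<le> \<epsilon>))"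
      by (rule closing[unfolded closing_lemma_def, rule_format, OF assms(2)])
    then obtain d T where d: "d > 0" "T > 0"
      and cl: "\<forall>y\<in>ball p \<epsilon>. \<forall>t\<ge>T. dist (\<phi> t y) y \<le> d \<longrightarrow>
        (\<exists>z\<in>ball y \<epsilon>. \<exists>\<tau>\<in>{t - \<epsilon>..t + \<epsilon>}. \<phi> \<tau> z = z \<and> (\<forall>s\<in>{0..t}. dist (\<phi> s z) (\<phi> s y) \<le> \<epsilon>))"
      by (elim exE conjE) (rule that)
    have "Q (min d (1 / T)) q" if q: "q \<in> ball p (\<epsilon>/2)" for q
      unfolding Q_def
    proof (intro allI impI, elim conjE)
      fix y t
      assume y: "dist q y < \<epsilon>/2" and t: "1 / min d (1 / T) \<le> t" and dt: "dist (\<phi> t y) y \<le> min d (1 / T)"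
      have "T \<le> 1 / min d (1 / T)"
        using d by (auto simp: min_def field_simps)
      then have "T \<le> t"
        using t by linarith
      moreover have "y \<in> ball p \<epsilon>"
        using y q dist_triangle[of p y q] by simp
      ultimately obtain z \<tau> where "\<tau> \<in> {t - \<epsilon>..t + \<epsilon>}" "\<phi> \<tau> z = z"
        "\<forall>s\<in>{0..t}. dist (\<phi> s z) (\<phi> s y) \<le> \<epsilon>"
        using cl[rule_format, of y t] dt by auto
      then show "\<exists>z \<tau>. \<tau> \<in> {t - \<epsilon>..t + \<epsilon>} \<and> \<phi> \<tau> z = z \<and>
          (\<forall>s\<in>{0..t}. dist (\<phi> s z) (\<phi> s y) \<le> \<epsilon>)"
        by (intro exI[of _ z] exI[of _ \<tau>] conjI)
    qed
    then show "\<exists>U e. open U \<and> p \<in> U \<and> e > 0 \<and> (\<forall>q\<in>U. Q e q)"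
      using d assms(2) by (intro exI[of _ "ball p (\<epsilon>/2)"] exI[of _ "min d (1 / T)"]) auto
  next
    fix e e' q assume "Q e q" and e: "0 < e'" "e' \<le> e"
    moreover have "1 / e \<le> 1 / e'"
      using e by (simp add: field_simps)
    ultimately show "Q e' q"
      unfolding Q_def using order_trans[of "1 / e" "1 / e'"] order_trans[of _ e' e] by blast
  qed
  then obtain e where "e > 0" "\<forall>q\<in>K. Q e q"
    by blast
  then show ?thesis
    using that[of e "1 / e"] unfolding Q_def by simp
qed

text \<open>Shadowing for five pieces, the number needed for every pseudo-orbit below: two segments or one
  segment and a periodic orbit, with three connecting pieces.\<close>

lemma five_piece_shadowing:
  assumes "compact K" "\<delta> > 0"
  obtains \<eta> where "\<eta> > 0"
    "\<And>x1 x2 x3 x4 x5 t1 t2 t3 t4 t5. {x1, x2, x3, x4, x5} \<subseteq> K \<Longrightarrow>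
      0 \<le> t1 \<Longrightarrow> 0 \<le> t2 \<Longrightarrow> 0 \<le> t3 \<Longrightarrow> 0 \<le> t4 \<Longrightarrow> 0 \<le> t5 \<Longrightarrow>
      dist (\<phi> t1 x1) x2 < \<eta> \<Longrightarrow> dist (\<phi> t2 x2) x3 < \<eta> \<Longrightarrow>
      dist (\<phi> t3 x3) x4 < \<eta> \<Longrightarrow> dist (\<phi> t4 x4) x5 < \<eta> \<Longrightarrow>
      \<exists>y. (\<forall>s\<in>{0..t1}. dist (\<phi> s y) (\<phi> s x1) < \<delta>) \<and>
         (\<forall>s\<in>{0..t2}. dist (\<phi> (s + t1) y) (\<phi> s x2) < \<delta>) \<and>
         (\<forall>s\<in>{0..t3}. dist (\<phi> (s + (t1 + t2)) y) (\<phi> s x3) < \<delta>) \<and>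
         (\<forall>s\<in>{0..t4}. dist (\<phi> (s + (t1 + t2 + t3)) y) (\<phi> s x4) < \<delta>) \<and>
         (\<forall>s\<in>{0..t5}. dist (\<phi> (s + (t1 + t2 + t3 + t4)) y) (\<phi> s x5) < \<delta>)"
proof -
  have "\<exists>\<eta>>0. \<forall>(x::nat \<Rightarrow> 'a) (t::nat \<Rightarrow> real).
      (\<forall>i\<in>{1..5}. x i \<in> K \<and> t i \<ge> 0) \<and>
      (\<forall>i. 1 \<le> i \<and> i < 5 \<longrightarrow> dist (\<phi> (t i) (x i)) (x (Suc i)) < \<eta>) \<longrightarrow>
      (\<exists>y. \<forall>i\<in>{1..5}. \<forall>s\<in>{0..t i}. dist (\<phi> (s + (\<Sum>j=1..<i. t j)) y) (\<phi> s (x i)) < \<delta>)"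
    using shadowing[unfolded finite_exact_shadowing_def, rule_format, OF assms, of 5] by simp
  then obtain \<eta> where \<eta>: "\<eta> > 0" and sh: "\<forall>(x::nat \<Rightarrow> 'a) (t::nat \<Rightarrow> real).
      (\<forall>i\<in>{1..5}. x i \<in> K \<and> t i \<ge> 0) \<and>
      (\<forall>i. 1 \<le> i \<and> i < 5 \<longrightarrow> dist (\<phi> (t i) (x i)) (x (Suc i)) < \<eta>) \<longrightarrow>
      (\<exists>y. \<forall>i\<in>{1..5}. \<forall>s\<in>{0..t i}. dist (\<phi> (s + (\<Sum>j=1..<i. t j)) y) (\<phi> s (x i)) < \<delta>)"
    by (elim exE conjE) (rule that)
  have five: "{1..5::nat} = {1, 2, 3, 4, 5}" "\<And>i::nat. 1 \<le> i \<and> i < 5 \<longleftrightarrow> i \<in> {1, 2, 3, 4}"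
    by auto
  show ?thesis
  proof (rule that[OF \<eta>])
    fix x1 x2 x3 x4 x5 and t1 t2 t3 t4 t5 :: real
    assume *: "{x1, x2, x3, x4, x5} \<subseteq> K" "0 \<le> t1" "0 \<le> t2" "0 \<le> t3" "0 \<le> t4" "0 \<le> t5"
      "dist (\<phi> t1 x1) x2 < \<eta>" "dist (\<phi> t2 x2) x3 < \<eta>" "dist (\<phi> t3 x3) x4 < \<eta>"
      "dist (\<phi> t4 x4) x5 < \<eta>"
    \<comment> \<open>Indices run from 1 to 5; the entry at 0 is a dummy.\<close>
    define x where "x = (\<lambda>i::nat. [x1, x1, x2, x3, x4, x5] ! i)"
    define t where "t = (\<lambda>i::nat. [t1, t1, t2, t3, t4, t5] ! i)"
    have x: "x 1 = x1" "x (Suc 0) = x1" "x 2 = x2" "x 3 = x3" "x 4 = x4" "x 5 = x5"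
      and t: "t 1 = t1" "t (Suc 0) = t1" "t 2 = t2" "t 3 = t3" "t 4 = t4" "t 5 = t5"
      by (simp_all add: x_def t_def numeral_eq_Suc)
    obtain y where y: "\<forall>i\<in>{1..5}. \<forall>s\<in>{0..t i}. dist (\<phi> (s + (\<Sum>j=1..<i. t j)) y) (\<phi> s (x i)) < \<delta>"
    proof -
      have "\<forall>i\<in>{1..5}. x i \<in> K \<and> t i \<ge> 0"
        using * unfolding five by (auto simp: x t)
      moreover have "\<forall>i. 1 \<le> i \<and> i < 5 \<longrightarrow> dist (\<phi> (t i) (x i)) (x (Suc i)) < \<eta>"
        using * unfolding five(2) by (auto simp: x t simp flip: numeral_2_eq_2)
      ultimately show ?thesis
        using spec[OF spec[OF sh, of x], of t] that by blast
    qed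
    have sets: "{1..<2::nat} = {1}" "{1..<3::nat} = {1, 2}" "{1..<4::nat} = {1, 2, 3}"
      "{1..<5::nat} = {1, 2, 3, 4}"
      by auto
    have y': "i \<in> {1..5} \<Longrightarrow> s \<in> {0..t i} \<Longrightarrow> dist (\<phi> (s + (\<Sum>j=1..<i. t j)) y) (\<phi> s (x i)) < \<delta>" for i s
      using y by blast
    show "\<exists>y. (\<forall>s\<in>{0..t1}. dist (\<phi> s y) (\<phi> s x1) < \<delta>) \<and>
         (\<forall>s\<in>{0..t2}. dist (\<phi> (s + t1) y) (\<phi> s x2) < \<delta>) \<and>
         (\<forall>s\<in>{0..t3}. dist (\<phi> (s + (t1 + t2)) y) (\<phi> s x3) < \<delta>) \<and>
         (\<forall>s\<in>{0..t4}. dist (\<phi> (s + (t1 + t2 + t3)) y) (\<phi> s x4) < \<delta>) \<and>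
         (\<forall>s\<in>{0..t5}. dist (\<phi> (s + (t1 + t2 + t3 + t4)) y) (\<phi> s x5) < \<delta>)"
    proof (intro exI[of _ y] conjI ballI)
      fix s assume "s \<in> {0..t1}"
      then show "dist (\<phi> s y) (\<phi> s x1) < \<delta>"
        using y'[of 1 s] by (simp add: x t)
    next
      fix s assume "s \<in> {0..t2}"
      then show "dist (\<phi> (s + t1) y) (\<phi> s x2) < \<delta>"
        using y'[of 2 s] unfolding sets by (simp add: x t)
    next
      fix s assume "s \<in> {0..t3}"
      then show "dist (\<phi> (s + (t1 + t2)) y) (\<phi> s x3) < \<delta>"
        using y'[of 3 s] unfolding sets by (simp add: x t)
    next
      fix s assume "s \<in> {0..t4}"
      then show "dist (\<phi> (s + (t1 + t2 + t3)) y) (\<phi> s x4) < \<delta>"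
        using y'[of 4 s] unfolding sets by (simp add: x t add.assoc)
    next
      fix s assume "s \<in> {0..t5}"
      then show "dist (\<phi> (s + (t1 + t2 + t3 + t4)) y) (\<phi> s x5) < \<delta>"
        using y'[of 5 s] unfolding sets by (simp add: x t add.assoc)
    qed
  qed
qed

section \<open>Periodic orbits\<close>

lemma flow_periodic_int:
  assumes "\<phi> T p = p"
  shows "\<phi> (of_int k * T) p = p"
proof -
  have nat: "\<phi> (real n * T) p = p" for n
    by (induction n) (simp_all add: distrib_right flow_add assms)
  then have "\<phi> (- (real n * T)) p = p" for n
    by (metis flow_inverse(1))
  with nat show ?thesis
    by (cases k) (simp_all add: of_nat_diff algebra_simps del: of_nat_Suc)
qed

lemma orbit_eq:
  assumes "p \<in> range (\<lambda>t. \<phi> t x)"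
  shows "range (\<lambda>t. \<phi> t x) = range (\<lambda>t. \<phi> t p)"
proof -
  obtain u where u: "p = \<phi> u x"
    using assms by blast
  have t: "\<phi> t x = \<phi> (t - u) p" "\<phi> t p = \<phi> (t + u) x" for t
    using flow_add[of "t - u" u x] flow_add[of t u x] u by simp_all
  show ?thesis
    using t(1) t(2) by (intro equalityI image_subsetI) (rule range_eqI, assumption)+
qed

lemma periodic_orbitsD:
  assumes "(\<gamma>, T) \<in> periodic_orbits \<phi>" "p \<in> \<gamma>"
  shows "T > 0" "\<phi> T p = p" "\<gamma> = range (\<lambda>t. \<phi> t p)"
proof -
  obtain x where x: "\<gamma> = range (\<lambda>t. \<phi> t x)" "T > 0" "\<phi> T x = x"
    using assms(1) unfolding periodic_orbits_def by blast
  show "T > 0" by fact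
  obtain u where u: "p = \<phi> u x"
    using assms(2) x(1) by blast
  show "\<phi> T p = p"
    using flow_add[of T u x] flow_add[of u T x] x(3) u by (simp add: add.commute)
  show "\<gamma> = range (\<lambda>t. \<phi> t p)"
    using orbit_eq assms(2) x(1) by blast
qed

lemma periodic_orbit_parameter:
  assumes "(\<gamma>, T) \<in> periodic_orbits \<phi>" "p \<in> \<gamma>" "q \<in> \<gamma>"
  shows "\<exists>\<theta>\<in>{0..T}. q = \<phi> \<theta> p"
proof -
  note p = periodic_orbitsD[OF assms(1,2)]
  obtain v where v: "q = \<phi> v p"
    using assms(3) p(3) by blast
  define \<theta> where "\<theta> = v - of_int \<lfloor>v / T\<rfloor> * T"
  have "\<theta> \<in> {0..T}"
    using floor_divide_lower[OF p(1), of v] floor_divide_upper[OF p(1), of v]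
    by (simp add: \<theta>_def distrib_right)
  moreover have "q = \<phi> \<theta> p"
    using flow_add[of \<theta> "of_int \<lfloor>v / T\<rfloor> * T" p] flow_periodic_int[OF p(2)] v
    by (simp add: \<theta>_def)
  ultimately show ?thesis
    by blast
qed

text \<open>Closeness of two periodic orbits during one period extends to all times by reparametrising
  linearly, so that the periods match. This is the form in which expansivity is applied.\<close>

lemma periodic_linear_shadow:
  assumes b: "\<And>t x. dist x (\<phi> t x) \<le> b * \<bar>t\<bar>" "b > 0"
    and per: "\<phi> T p = p" "\<phi> T' q = q" "0 < T" "T \<le> T'" "b * (T' - T) \<le> e"
    and close: "\<And>u. u \<in> {0..T} \<Longrightarrow> dist (\<phi> u p) (\<phi> u q) < e"
  shows "dist (\<phi> t p) (\<phi> (t * (T' / T)) q) \<le> 2 * e"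
proof -
  define k r where "k = \<lfloor>t / T\<rfloor>" and "r = t - of_int k * T"
  have r: "0 \<le> r" "r \<le> T"
    using floor_divide_lower[OF per(3), of t] floor_divide_upper[OF per(3), of t]
    by (simp_all add: r_def k_def distrib_right)
  have "\<phi> t p = \<phi> r p"
    using flow_add[of r "of_int k * T" p] flow_periodic_int[OF per(1)] by (simp add: r_def)
  moreover have "t * (T' / T) = r * (T' / T) + of_int k * T'"
    using per(3) by (simp add: r_def field_simps)
  then have "\<phi> (t * (T' / T)) q = \<phi> (r * (T' / T)) q"
    using flow_add flow_periodic_int[OF per(2)] by simp
  moreover have "dist (\<phi> r q) (\<phi> (r * (T' / T)) q) \<le> e"
  proof -
    define d where "d = r * (T' / T) - r"
    have d: "d = r / T * (T' - T)"
      using per(3) by (simp add: d_def field_simps)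
    have "0 \<le> r / T" "r / T \<le> 1"
      using r per(3) by auto
    then have "0 \<le> d" "d \<le> 1 * (T' - T)"
      unfolding d using per(4)
      by (simp_all only: mult_nonneg_nonneg mult_right_mono diff_ge_0_iff_ge)
    then have "b * \<bar>d\<bar> \<le> b * (T' - T)"
      using b(2) by simp
    moreover have "\<phi> (r * (T' / T)) q = \<phi> d (\<phi> r q)"
      using flow_add[of d r q] by (simp add: d_def)
    ultimately show ?thesis
      using b(1)[of "\<phi> r q" d] per(5) by simp
  qed
  moreover have "dist (\<phi> r p) (\<phi> r q) < e"
    using close r by simp
  ultimately show ?thesis
    using dist_triangle[of "\<phi> r p" "\<phi> (r * (T' / T)) q" "\<phi> r q"] by simp
qed

section \<open>Separated families of orbit segments\<close>

text \<open>The pair \<open>(p, t)\<close> stands for the orbit segment of length \<open>t\<close> starting at \<open>p\<close>; both ends are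
  required to lie in \<open>K\<close>. Chords and periodic orbits both give rise to such families.\<close>

definition segments :: "'a set \<Rightarrow> real \<Rightarrow> real \<Rightarrow> ('a \<times> real) set" where
  "segments K L \<sigma> = {(p, t). p \<in> K \<and> \<phi> t p \<in> K \<and> L \<le> t \<and> t \<le> L + \<sigma>}"

text \<open>Two segments are separated if they are at distance at least \<open>\<delta>\<close> at some time common to both.
  In particular, for \<open>\<delta> > 0\<close>, segments with the same starting point must coincide.\<close>

definition separated_segments :: "real \<Rightarrow> ('a \<times> real) set \<Rightarrow> bool" where
  "separated_segments \<delta> I \<longleftrightarrow>
     (\<forall>(p, s)\<in>I. \<forall>(q, t)\<in>I. (p, s) \<noteq> (q, t) \<longrightarrow>
        (\<exists>u\<in>{0..min s t}. dist (\<phi> u p) (\<phi> u q) \<ge> \<delta>))"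

lemma segmentsD:
  assumes "(p, t) \<in> segments K L \<sigma>"
  shows "p \<in> K" "\<phi> t p \<in> K" "L \<le> t" "t \<le> L + \<sigma>"
  using assms unfolding segments_def by auto

lemma separated_segmentsD:
  assumes "separated_segments \<delta> I" "(p, s) \<in> I" "(q, t) \<in> I" "(p, s) \<noteq> (q, t)"
  shows "\<exists>u\<in>{0..min s t}. dist (\<phi> u p) (\<phi> u q) \<ge> \<delta>"
  using assms unfolding separated_segments_def by fastforce

lemma separated_segmentsI:
  assumes "\<And>p s q t. (p, s) \<in> I \<Longrightarrow> (q, t) \<in> I \<Longrightarrow> (p, s) \<noteq> (q, t) \<Longrightarrow>
    \<exists>u\<in>{0..min s t}. dist (\<phi> u p) (\<phi> u q) \<ge> \<delta>"
  shows "separated_segments \<delta> I"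
  unfolding separated_segments_def by (intro ballI case_prodI2 impI) (use assms in blast)

lemma separating_card_bound:
  assumes "compact K" "\<delta> > 0"
  shows "\<exists>n::nat. \<forall>W\<subseteq>K. separating \<phi> \<delta> T W \<longrightarrow> finite W \<and> card W \<le> n"
proof -
  obtain \<Lambda> where \<Lambda>: "\<Lambda> > 0" "\<And>t x y. t \<in> {0..T} \<Longrightarrow> dist (\<phi> t x) (\<phi> t y) \<le> \<Lambda> * dist x y"
    using lipschitz_bounded_time[of T] by blast
  obtain n where n: "\<And>W. W \<subseteq> K \<Longrightarrow> (\<forall>p\<in>W. \<forall>q\<in>W. p \<noteq> q \<longrightarrow> dist p q \<ge> \<delta> / \<Lambda>) \<Longrightarrow>
      finite W \<and> card W \<le> n"
    using compact_uniformly_discrete_card[OF assms(1), of "\<delta> / \<Lambda>"] assms(2) \<Lambda>(1) by auto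
  have "finite W \<and> card W \<le> n" if W: "W \<subseteq> K" "separating \<phi> \<delta> T W" for W
  proof (rule n[OF W(1)], intro ballI impI)
    fix p q assume "p \<in> W" "q \<in> W" "p \<noteq> q"
    then obtain t where "t \<in> {0..T}" "\<delta> \<le> dist (\<phi> t p) (\<phi> t q)"
      using W(2) unfolding separating_def by blast
    with \<Lambda>(2)[of t p q] have "\<delta> \<le> \<Lambda> * dist p q"
      by simp
    then show "\<delta> / \<Lambda> \<le> dist p q"
      using \<Lambda>(1) by (simp add: field_simps)
  qed
  then show ?thesis
    by blast
qed

lemma separated_segments_finite:
  assumes "compact K" "\<delta> > 0" "I \<subseteq> segments K L \<sigma>" "separated_segments \<delta> I"
  shows "finite I"
proof -
  have "inj_on fst I"
  proof (rule inj_onI, rule ccontr)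
    fix i j assume ij: "i \<in> I" "j \<in> I" "fst i = fst j" "i \<noteq> j"
    obtain p s q t where eq: "i = (p, s)" "j = (q, t)"
      by (metis surj_pair)
    then obtain u where "\<delta> \<le> dist (\<phi> u p) (\<phi> u q)"
      using separated_segmentsD[OF assms(4)] ij by metis
    then show False
      using ij(3) eq assms(2) by simp
  qed
  moreover have "finite (fst ` I)"
  proof -
    have "separating \<phi> \<delta> (L + \<sigma>) (fst ` I)"
      unfolding separating_def
    proof (intro ballI impI)
      fix p q assume "p \<in> fst ` I" "q \<in> fst ` I" "p \<noteq> q"
      then obtain s t where st: "(p, s) \<in> I" "(q, t) \<in> I" "p \<noteq> q"
        by auto
      moreover have "s \<le> L + \<sigma>"
        using assms(3) st segmentsD(4) by blast
      ultimately show "\<exists>t\<in>{0..L + \<sigma>}. \<delta> \<le> dist (\<phi> t p) (\<phi> t q)"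
        using separated_segmentsD[OF assms(4) st(1,2)] by force
    qed
    moreover have "fst ` I \<subseteq> K"
      using assms(3) segmentsD(1) by fastforce
    ultimately show ?thesis
      using separating_card_bound[OF assms(1,2)] by blast
  qed
  ultimately show ?thesis
    by (rule inj_on_finite[OF _ subset_refl])
qed

text \<open>Expansivity: periodic orbits through a compact set whose periods lie in a common short window
  are separated at a scale \<open>\<alpha>\<close> that depends on the flow only.\<close>

lemma periodic_orbits_separated:
  "\<exists>\<alpha>>0. \<forall>K. compact K \<longrightarrow> (\<exists>w0>0. \<forall>w. 0 < w \<and> w \<le> w0 \<longrightarrow>
     (\<forall>L. finite (periodic_orbits_between \<phi> K L (L + w)) \<and>
       (\<exists>I. finite I \<and> I \<subseteq> segments K L w \<and> separated_segments \<alpha> I \<and>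
            card I = card (periodic_orbits_between \<phi> K L (L + w)))))"
proof -
  obtain b where b: "b > 0" "\<And>t x. dist x (\<phi> t x) \<le> b * \<bar>t\<bar>"
    using displacement by blast
  obtain \<epsilon> where \<epsilon>: "\<epsilon> > 0" and ex: "\<And>x y. (\<exists>s::real \<Rightarrow> real. continuous_on UNIV s \<and> s 0 = 0 \<and>
      (\<forall>t. dist (\<phi> t x) (\<phi> (s t) y) \<le> \<epsilon>)) \<Longrightarrow> \<exists>\<tau>\<in>{-1..1}. y = \<phi> \<tau> x"
    using expansive[unfolded expansive_flow_def, rule_format, of 1] by auto
  define \<alpha> where "\<alpha> = \<epsilon> / 2"
  have \<alpha>: "\<alpha> > 0"
    using \<epsilon> by (simp add: \<alpha>_def)
  have "\<exists>w0>0. \<forall>w. 0 < w \<and> w \<le> w0 \<longrightarrow>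
     (\<forall>L. finite (periodic_orbits_between \<phi> K L (L + w)) \<and>
       (\<exists>I. finite I \<and> I \<subseteq> segments K L w \<and> separated_segments \<alpha> I \<and>
            card I = card (periodic_orbits_between \<phi> K L (L + w))))" if K: "compact K" for K
  proof -
    obtain w1 where w1: "w1 > 0" "\<And>p t. p \<in> K \<Longrightarrow> 0 < t \<Longrightarrow> t \<le> w1 \<Longrightarrow> \<phi> t p \<noteq> p"
      using period_lower_bound[OF K] by blast
    define w0 where "w0 = min w1 (\<alpha> / b)"
    have sep: "\<exists>u\<in>{0..T}. \<alpha> \<le> dist (\<phi> u p) (\<phi> u q)"
      if pq: "(\<gamma>, T) \<in> periodic_orbits \<phi>" "p \<in> \<gamma> \<inter> K" "(\<gamma>', T') \<in> periodic_orbits \<phi>" "q \<in> \<gamma>' \<inter> K"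
        and T: "T \<le> T'" "T' \<le> T + w0" and ne: "(\<gamma>, T) \<noteq> (\<gamma>', T')" for \<gamma> T p \<gamma>' T' q
    proof (rule ccontr)
      assume neg: "\<not> ?thesis"
      note p = periodic_orbitsD[OF pq(1), of p] and q = periodic_orbitsD[OF pq(3), of q]
      have "b * (T' - T) \<le> b * (\<alpha> / b)"
        using T b(1) unfolding w0_def by (intro mult_left_mono) auto
      then have "b * (T' - T) \<le> \<alpha>"
        using b(1) by simp
      moreover have "dist (\<phi> u p) (\<phi> u q) < \<alpha>" if "u \<in> {0..T}" for u
        using neg that by (meson not_le)
      moreover have "0 < T" "\<phi> T p = p" "\<phi> T' q = q"
        using p q pq by blast+
      ultimately have "dist (\<phi> t p) (\<phi> (t * (T' / T)) q) \<le> \<epsilon>" for t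
        using periodic_linear_shadow[OF b(2,1), of T p T' q \<alpha> t] T(1) by (simp add: \<alpha>_def)
      moreover have "continuous_on UNIV (\<lambda>t. t * (T' / T))"
        by (intro continuous_on_mult continuous_on_id continuous_on_const)
      ultimately have "\<exists>s::real \<Rightarrow> real. continuous_on UNIV s \<and> s 0 = 0 \<and>
          (\<forall>t. dist (\<phi> t p) (\<phi> (s t) q) \<le> \<epsilon>)"
        by (intro exI[of _ "\<lambda>t. t * (T' / T)"]) simp
      then obtain \<tau> where "q = \<phi> \<tau> p"
        using ex by blast
      then have "q \<in> \<gamma>"
        using p(3) pq by blast
      then have "\<gamma> = \<gamma>'"
        using periodic_orbitsD(3)[OF pq(1)] q(3) pq(4) by blast
      then have "T < T'"
        using ne T(1) by auto
      moreover have "\<phi> T p = p" "\<phi> T' p = p"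
        using periodic_orbitsD(2)[OF pq(1)] periodic_orbitsD(2)[OF pq(3)] pq(2) \<open>\<gamma> = \<gamma>'\<close> by blast+
      then have "\<phi> (T' - T) p = p"
        using flow_add[of "T' - T" T p] by simp
      moreover have "T' - T \<le> w1"
        using T(2) unfolding w0_def by linarith
      ultimately show False
        using w1(2)[of p "T' - T"] pq(2) by auto
    qed
    have "finite (periodic_orbits_between \<phi> K L (L + w)) \<and>
       (\<exists>I. finite I \<and> I \<subseteq> segments K L w \<and> separated_segments \<alpha> I \<and>
            card I = card (periodic_orbits_between \<phi> K L (L + w)))" if w: "0 < w" "w \<le> w0" for w L
    proof -
      define P where "P = periodic_orbits_between \<phi> K L (L + w)"
      define rep where "rep \<gamma> = (SOME p. p \<in> \<gamma> \<inter> K)" for \<gamma>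
      have P: "(\<gamma>, T) \<in> periodic_orbits \<phi>" "T \<in> {L..L + w}" "rep \<gamma> \<in> \<gamma> \<inter> K"
        if "(\<gamma>, T) \<in> P" for \<gamma> T
      proof -
        show "(\<gamma>, T) \<in> periodic_orbits \<phi>" "T \<in> {L..L + w}"
          using that unfolding P_def periodic_orbits_between_def by auto
        have "\<exists>p. p \<in> \<gamma> \<inter> K"
          using that unfolding P_def periodic_orbits_between_def by auto
        then show "rep \<gamma> \<in> \<gamma> \<inter> K"
          unfolding rep_def by (rule someI_ex)
      qed
      define f where "f = (\<lambda>(\<gamma>, T::real). (rep \<gamma>, T))"
      have sepP: "\<exists>u\<in>{0..min T T'}. \<alpha> \<le> dist (\<phi> u (rep \<gamma>)) (\<phi> u (rep \<gamma>'))"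
        if "(\<gamma>, T) \<in> P" "(\<gamma>', T') \<in> P" "(\<gamma>, T) \<noteq> (\<gamma>', T')" for \<gamma> T \<gamma>' T'
      proof (cases "T \<le> T'")
        case True
        then show ?thesis
          using sep[of \<gamma> T "rep \<gamma>" \<gamma>' T' "rep \<gamma>'"] P[OF that(1)] P[OF that(2)] that(3) w
          by auto
      next
        case False
        then show ?thesis
          using sep[of \<gamma>' T' "rep \<gamma>'" \<gamma> T "rep \<gamma>"] P[OF that(1)] P[OF that(2)] that(3) w
          by (auto simp: dist_commute)
      qed
      have inj: "inj_on f P"
        using sepP \<alpha> by (fastforce simp: inj_on_def f_def)
      have sub: "f ` P \<subseteq> segments K L w"
        using P periodic_orbitsD(2) by (fastforce simp: f_def segments_def)
      have sg: "separated_segments \<alpha> (f ` P)"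
        using sepP unfolding separated_segments_def f_def by fastforce
      have "finite (f ` P)"
        using separated_segments_finite[OF K \<alpha> sub sg] .
      then show ?thesis
        using inj sub sg card_image[OF inj] finite_imageD[OF _ inj] unfolding P_def by blast
    qed
    moreover have "w0 > 0"
      using w1(1) \<alpha> b(1) by (simp add: w0_def)
    ultimately show ?thesis
      by blast
  qed
  then show ?thesis
    using \<alpha> by blast
qed

text \<open>A long window of periods is cut into windows of length \<open>w\<close>.\<close>

lemma card_periodic_orbits_window:
  assumes "w > 0" "c \<ge> 0" and fin: "\<And>L. finite (periodic_orbits_between \<phi> K L (L + w))"
  shows "\<exists>n::nat>0. \<forall>L. finite (periodic_orbits_between \<phi> K L (L + c)) \<and>
    (\<exists>L'\<in>{L..L + c}. card (periodic_orbits_between \<phi> K L (L + c)) \<le>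
       n * card (periodic_orbits_between \<phi> K L' (L' + w)))"
proof -
  define m where "m = nat \<lfloor>c / w\<rfloor>"
  have "finite (periodic_orbits_between \<phi> K L (L + c)) \<and>
    (\<exists>L'\<in>{L..L + c}. card (periodic_orbits_between \<phi> K L (L + c)) \<le>
       Suc m * card (periodic_orbits_between \<phi> K L' (L' + w)))" for L
  proof -
    define P where "P = periodic_orbits_between \<phi> K L (L + c)"
    define f where "f = (\<lambda>(\<gamma>::'a set, T). nat \<lfloor>(T - L) / w\<rfloor>)"
    have f: "f (\<gamma>, T) \<le> m \<and> L + real (f (\<gamma>, T)) * w \<le> T \<and> T \<le> L + real (f (\<gamma>, T)) * w + w"
      if "(\<gamma>, T) \<in> P" for \<gamma> T
    proof -
      have T: "0 \<le> T - L" "T - L \<le> c"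
        using that unfolding P_def periodic_orbits_between_def by auto
      have "real (f (\<gamma>, T)) \<le> (T - L) / w" "(T - L) / w \<le> real (f (\<gamma>, T)) + 1"
        using T(1) assms(1) by (auto simp: f_def)
      moreover have "f (\<gamma>, T) \<le> m"
        unfolding f_def m_def using T assms(1) by (auto intro!: nat_mono floor_mono divide_right_mono)
      ultimately show ?thesis
        using assms(1) by (auto simp: field_simps)
    qed
    define Q where "Q k = periodic_orbits_between \<phi> K (L + real k * w) (L + real k * w + w)" for k
    have fibre: "{i \<in> P. f i = k} \<subseteq> Q k" for k
      using f unfolding Q_def by (fastforce simp: P_def periodic_orbits_between_def)
    have "P \<subseteq> (\<Union>k\<le>m. Q k)"
      using fibre f by fast
    then have finP: "finite P"
      by (rule finite_subset) (auto simp: Q_def fin)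
    moreover have "f ` P \<subseteq> {..m}"
      using f by auto
    ultimately obtain k where k: "k \<in> {..m}" "card P \<le> card {..m} * card {i \<in> P. f i = k}"
      using pigeonhole_fibre[of P "{..m}" f] by blast
    have "card {i \<in> P. f i = k} \<le> card (Q k)"
      by (rule card_mono[OF _ fibre]) (simp add: Q_def fin)
    then have "card P \<le> Suc m * card (Q k)"
      using k(2) mult_le_mono2[of _ "card (Q k)" "Suc m"] by (simp add: order_trans)
    moreover have "real k * w \<le> c"
    proof -
      have "real k \<le> real m"
        using k by simp
      also have "\<dots> \<le> c / w"
        using assms by (simp add: m_def)
      finally show ?thesis
        using assms(1) by (simp add: field_simps)
    qed
    ultimately show ?thesis
      using finP assms(1) unfolding P_def Q_def by (intro conjI bexI[of _ "L + real k * w"]) auto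
  qed
  then show ?thesis
    by blast
qed

lemma finite_periodic_orbits:
  assumes "compact K"
  shows "finite (periodic_orbits_between \<phi> K L L')"
proof -
  obtain w where w: "w > 0" "\<And>L. finite (periodic_orbits_between \<phi> K L (L + w))"
    using periodic_orbits_separated assms by (meson order_refl)
  have "finite (periodic_orbits_between \<phi> K L (L + max 0 (L' - L)))"
    using card_periodic_orbits_window[OF w(1) _ w(2), of "max 0 (L' - L)"] by auto
  moreover have "periodic_orbits_between \<phi> K L L' \<subseteq>
      periodic_orbits_between \<phi> K L (L + max 0 (L' - L))"
    by (auto simp: periodic_orbits_between_def)
  ultimately show ?thesis
    by (rule rev_finite_subset)
qed

text \<open>E-sets are the separated sets of chords that are maximal with respect to inclusion, so the chord
  number is the maximal cardinality of a separated set of chords.\<close>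

lemma chord_number_attained:
  assumes "compact K" "ball x \<eta> \<subseteq> K" "\<delta> > 0"
  shows "\<exists>n. chord_number \<phi> x y \<eta> T T' \<delta> = enat n \<and>
    (\<forall>W. W \<subseteq> chords \<phi> x y \<eta> T T' \<and> separating \<phi> \<delta> T W \<longrightarrow> card W \<le> n) \<and>
    (\<exists>E. finite E \<and> E \<subseteq> chords \<phi> x y \<eta> T T' \<and> separating \<phi> \<delta> T E \<and> card E = n)"
proof -
  define X where "X = chords \<phi> x y \<eta> T T'"
  have X: "X \<subseteq> K"
    using assms(2) by (auto simp: X_def chords_def)
  obtain N where N: "\<And>W. W \<subseteq> X \<Longrightarrow> separating \<phi> \<delta> T W \<Longrightarrow> finite W \<and> card W \<le> N"
    using separating_card_bound[OF assms(1,3)] X by (meson subset_trans)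
  define S where "S = {W. W \<subseteq> X \<and> separating \<phi> \<delta> T W}"
  have "card ` S \<subseteq> {..N}"
    using N by (auto simp: S_def)
  then have fin: "finite (card ` S)"
    by (rule finite_subset) simp
  moreover have "{} \<in> S"
    by (auto simp: S_def separating_def)
  ultimately have "Max (card ` S) \<in> card ` S"
    by (intro Max_in) auto
  then obtain E where E: "E \<subseteq> X" "separating \<phi> \<delta> T E" "card E = Max (card ` S)"
    by (auto simp: S_def)
  have max: "card W \<le> card E" if "W \<subseteq> X" "separating \<phi> \<delta> T W" for W
    using that fin E(3) by (auto simp: S_def)
  have finE: "finite E"
    using N E by blast
  have "E_set \<phi> x y \<eta> T T' \<delta> E"
    unfolding E_set_def X_def[symmetric]
  proof (intro conjI E(1,2) subsetI)
    fix z assume z: "z \<in> X"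
    show "z \<in> (\<Union>z\<in>E. dyn_ball \<phi> z \<delta> T)"
    proof (rule ccontr)
      assume neg: "z \<notin> (\<Union>z\<in>E. dyn_ball \<phi> z \<delta> T)"
      then have far: "\<exists>t\<in>{0..T}. \<delta> \<le> dist (\<phi> t p) (\<phi> t z)" if "p \<in> E" for p
        using that by (force simp: dyn_ball_def not_less)
      then have "separating \<phi> \<delta> T (insert z E)"
        using E(2) far unfolding separating_def by (metis dist_commute insert_iff)
      then have "card (insert z E) \<le> card E"
        using max z E(1) by blast
      then have "z \<in> E"
        using finE by (auto simp: card_insert_if split: if_splits)
      then show False
        using far[of z] assms(3) by auto
    qed
  qed
  then have "enat (card E) \<le> chord_number \<phi> x y \<eta> T T' \<delta>"
    unfolding chord_number_def using finE by (intro Sup_upper) (auto simp: ecard_def)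
  moreover have "chord_number \<phi> x y \<eta> T T' \<delta> \<le> enat (card E)"
    unfolding chord_number_def
    using max N by (intro Sup_least) (auto simp: E_set_def ecard_def X_def)
  ultimately show ?thesis
    using E finE max unfolding X_def by (intro exI[of _ "card E"]) auto
qed

section \<open>Gluing orbit segments\<close>


text \<open>Two segments starting and ending in a compact set, connected by orbits of which the first one
  comes close to \<open>z0\<close>, are followed by a single periodic orbit.\<close>

lemma periodic_orbit_through_segments:
  assumes "compact K" "z0 \<in> K" "\<epsilon> > 0"
  obtains \<eta> T where "\<eta> > 0" "T > 0"
    "\<And>p1 t1 u s2 v s3 p2 t2 x s5. {p1, \<phi> t1 p1, p2, \<phi> t2 p2} \<subseteq> K \<Longrightarrow>
      0 \<le> t1 \<Longrightarrow> T \<le> s2 \<Longrightarrow> 0 \<le> s3 \<Longrightarrow> 0 \<le> t2 \<Longrightarrow> 0 \<le> s5 \<Longrightarrow>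
      dist (\<phi> t1 p1) u < \<eta> \<Longrightarrow> dist (\<phi> s2 u) v < \<eta> \<Longrightarrow> dist v z0 < \<eta> \<Longrightarrow>
      dist (\<phi> s3 v) p2 < \<eta> \<Longrightarrow> dist (\<phi> t2 p2) x < \<eta> \<Longrightarrow> dist (\<phi> s5 x) p1 < \<eta> \<Longrightarrow>
      \<exists>z \<tau>. \<tau> \<in> {t1 + s2 + s3 + t2 + s5 - \<epsilon>..t1 + s2 + s3 + t2 + s5 + \<epsilon>} \<and> \<phi> \<tau> z = z \<and>
        (\<forall>s\<in>{0..t1}. dist (\<phi> s z) (\<phi> s p1) < 2 * \<epsilon>) \<and>
        (\<forall>s\<in>{0..t2}. dist (\<phi> (s + (t1 + s2 + s3)) z) (\<phi> s p2) < 2 * \<epsilon>) \<and>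
        dist (\<phi> (t1 + s2) z) z0 < 3 * \<epsilon>"
proof -
  obtain r K1 where r: "r > 0" "compact K1" "\<And>q. q \<in> K \<Longrightarrow> ball q r \<subseteq> K1"
    using compact_neighbourhood[OF assms(1) locally_compact] by blast
  obtain d T where d: "d > 0" "T > 0" and
    cl: "\<And>p y t. p \<in> K \<Longrightarrow> dist p y < \<epsilon>/2 \<Longrightarrow> t \<ge> T \<Longrightarrow> dist (\<phi> t y) y \<le> d \<Longrightarrow>
      \<exists>z \<tau>. \<tau> \<in> {t - \<epsilon>..t + \<epsilon>} \<and> \<phi> \<tau> z = z \<and> (\<forall>s\<in>{0..t}. dist (\<phi> s z) (\<phi> s y) \<le> \<epsilon>)"
    using uniform_closing[OF assms(1,3)] by metis
  define \<delta> where "\<delta> = min (\<epsilon> / 2) (d / 4)"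
  have \<delta>: "\<delta> > 0" "\<delta> \<le> \<epsilon> / 2" "\<delta> \<le> d / 4"
    using assms(3) d by (auto simp: \<delta>_def)
  obtain \<eta>0 where \<eta>0: "\<eta>0 > 0" and
    sh: "\<And>x1 x2 x3 x4 x5 t1 t2 t3 t4 t5. {x1, x2, x3, x4, x5} \<subseteq> K1 \<Longrightarrow>
      0 \<le> t1 \<Longrightarrow> 0 \<le> t2 \<Longrightarrow> 0 \<le> t3 \<Longrightarrow> 0 \<le> t4 \<Longrightarrow> 0 \<le> t5 \<Longrightarrow>
      dist (\<phi> t1 x1) x2 < \<eta>0 \<Longrightarrow> dist (\<phi> t2 x2) x3 < \<eta>0 \<Longrightarrow>
      dist (\<phi> t3 x3) x4 < \<eta>0 \<Longrightarrow> dist (\<phi> t4 x4) x5 < \<eta>0 \<Longrightarrow>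
      \<exists>y. (\<forall>s\<in>{0..t1}. dist (\<phi> s y) (\<phi> s x1) < \<delta>) \<and>
         (\<forall>s\<in>{0..t2}. dist (\<phi> (s + t1) y) (\<phi> s x2) < \<delta>) \<and>
         (\<forall>s\<in>{0..t3}. dist (\<phi> (s + (t1 + t2)) y) (\<phi> s x3) < \<delta>) \<and>
         (\<forall>s\<in>{0..t4}. dist (\<phi> (s + (t1 + t2 + t3)) y) (\<phi> s x4) < \<delta>) \<and>
         (\<forall>s\<in>{0..t5}. dist (\<phi> (s + (t1 + t2 + t3 + t4)) y) (\<phi> s x5) < \<delta>)"
    using that by (rule five_piece_shadowing[OF r(2) \<delta>(1)])
  define \<eta> where "\<eta> = Min {\<eta>0, r, \<epsilon>, d / 4}"
  have \<eta>: "\<eta> > 0" "\<eta> \<le> \<eta>0" "\<eta> \<le> r" "\<eta> \<le> \<epsilon>" "\<eta> \<le> d / 4"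
    using \<eta>0 r(1) assms(3) d(1) by (auto simp: \<eta>_def)
  show thesis
  proof (rule that[OF \<eta>(1) d(2)])
    fix p1 t1 u s2 v s3 p2 t2 x s5
    assume K: "{p1, \<phi> t1 p1, p2, \<phi> t2 p2} \<subseteq> K"
      and nonneg: "0 \<le> t1" "T \<le> s2" "0 \<le> s3" "0 \<le> t2" "0 \<le> s5"
      and gap: "dist (\<phi> t1 p1) u < \<eta>" "dist (\<phi> s2 u) v < \<eta>" "dist v z0 < \<eta>"
        "dist (\<phi> s3 v) p2 < \<eta>" "dist (\<phi> t2 p2) x < \<eta>" "dist (\<phi> s5 x) p1 < \<eta>"
    have s2: "0 \<le> s2"
      using nonneg(2) d(2) by linarith
    have K1: "q \<in> K1" if "q' \<in> K" "dist q' q < \<eta>" for q q'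
      using r(3)[OF that(1)] that(2) \<eta>(3) by auto
    have "{p1, u, v, p2, x} \<subseteq> K1"
      using K gap assms(2) K1[of p1 p1] K1[of "\<phi> t1 p1" u] K1[of z0 v] K1[of p2 p2]
        K1[of "\<phi> t2 p2" x] \<eta>(1) by (simp add: dist_commute)
    from sh[OF this nonneg(1) s2 nonneg(3-5)] gap \<eta>(2) obtain y where
      y: "\<forall>s\<in>{0..t1}. dist (\<phi> s y) (\<phi> s p1) < \<delta>"
         "\<forall>s\<in>{0..s3}. dist (\<phi> (s + (t1 + s2)) y) (\<phi> s v) < \<delta>"
         "\<forall>s\<in>{0..t2}. dist (\<phi> (s + (t1 + s2 + s3)) y) (\<phi> s p2) < \<delta>"
         "\<forall>s\<in>{0..s5}. dist (\<phi> (s + (t1 + s2 + s3 + t2)) y) (\<phi> s x) < \<delta>"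
      by auto
    define t where "t = t1 + s2 + s3 + t2 + s5"
    have y0: "dist y p1 < \<delta>" and yv: "dist (\<phi> (t1 + s2) y) v < \<delta>"
      and yt: "dist (\<phi> t y) (\<phi> s5 x) < \<delta>"
      using y(1)[rule_format, of 0] y(2)[rule_format, of 0] y(4)[rule_format, of s5] nonneg
      by (simp_all add: t_def add_ac)
    have "dist (\<phi> t y) y \<le> dist (\<phi> t y) (\<phi> s5 x) + dist (\<phi> s5 x) p1 + dist p1 y"
      by (rule dist_triangle_three)
    also have "\<dots> \<le> d"
      using yt gap(6) y0 \<delta>(3) \<eta>(5) d(1) by (simp add: dist_commute)
    finally have "dist (\<phi> t y) y \<le> d" .
    moreover have "dist p1 y < \<epsilon> / 2"
      using y0 \<delta>(2) by (simp add: dist_commute)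
    moreover have "T \<le> t"
      using nonneg by (simp add: t_def)
    ultimately obtain z \<tau> where z: "\<tau> \<in> {t - \<epsilon>..t + \<epsilon>}" "\<phi> \<tau> z = z"
        "\<And>s. s \<in> {0..t} \<Longrightarrow> dist (\<phi> s z) (\<phi> s y) \<le> \<epsilon>"
      using cl[of p1 y t] K by blast
    have "dist (\<phi> s z) (\<phi> s p1) < 2 * \<epsilon>" if "s \<in> {0..t1}" for s
    proof -
      have "dist (\<phi> s z) (\<phi> s y) \<le> \<epsilon>" "dist (\<phi> s y) (\<phi> s p1) < \<delta>"
        using z(3)[of s] y(1) that nonneg s2 by (simp_all add: t_def)
      then show ?thesis
        using dist_triangle[of "\<phi> s z" "\<phi> s p1" "\<phi> s y"] \<delta>(2) assms(3) by simp
    qed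
    moreover have "dist (\<phi> (s + (t1 + s2 + s3)) z) (\<phi> s p2) < 2 * \<epsilon>" if "s \<in> {0..t2}" for s
    proof -
      have "dist (\<phi> (s + (t1 + s2 + s3)) z) (\<phi> (s + (t1 + s2 + s3)) y) \<le> \<epsilon>"
        "dist (\<phi> (s + (t1 + s2 + s3)) y) (\<phi> s p2) < \<delta>"
        using z(3)[of "s + (t1 + s2 + s3)"] y(3) that nonneg s2 by (simp_all add: t_def)
      then show ?thesis
        using dist_triangle[of "\<phi> (s + (t1 + s2 + s3)) z" "\<phi> s p2" "\<phi> (s + (t1 + s2 + s3)) y"]
          \<delta>(2) assms(3) by simp
    qed
    moreover have "dist (\<phi> (t1 + s2) z) z0 < 3 * \<epsilon>"
    proof -
      have "dist (\<phi> (t1 + s2) z) (\<phi> (t1 + s2) y) \<le> \<epsilon>"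
        using z(3)[of "t1 + s2"] nonneg s2 by (simp add: t_def)
      moreover have "dist (\<phi> (t1 + s2) z) z0 \<le>
          dist (\<phi> (t1 + s2) z) (\<phi> (t1 + s2) y) + dist (\<phi> (t1 + s2) y) v + dist v z0"
        by (rule dist_triangle_three)
      ultimately show ?thesis
        using yv gap(3) \<delta>(2) \<eta>(4) assms(3) by linarith
    qed
    ultimately show "\<exists>z \<tau>. \<tau> \<in> {t1 + s2 + s3 + t2 + s5 - \<epsilon>..t1 + s2 + s3 + t2 + s5 + \<epsilon>} \<and>
        \<phi> \<tau> z = z \<and>
        (\<forall>s\<in>{0..t1}. dist (\<phi> s z) (\<phi> s p1) < 2 * \<epsilon>) \<and>
        (\<forall>s\<in>{0..t2}. dist (\<phi> (s + (t1 + s2 + s3)) z) (\<phi> s p2) < 2 * \<epsilon>) \<and>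
        dist (\<phi> (t1 + s2) z) z0 < 3 * \<epsilon>"
      using z(1,2) unfolding t_def by (intro exI[of _ z] exI[of _ \<tau>]) simp
  qed
qed

text \<open>Gluing two separated families: the resulting periodic orbits, together with a position along
  the orbit (at resolution \<open>\<kappa>\<close>), determine the pair of segments. Since the period is of the order
  of \<open>L1 + L2\<close>, this costs a factor linear in \<open>L1 + L2\<close>.\<close>

lemma glue_two_families:
  assumes "compact K0" "compact K" "z0 \<in> interior K" "\<delta> > 0" "\<sigma> \<ge> 0"
  obtains C c :: real where "C > 0" "c > 0"
    "\<And>L1 L2 I1 I2. 0 \<le> L1 \<Longrightarrow> 0 \<le> L2 \<Longrightarrow> finite I1 \<Longrightarrow> finite I2 \<Longrightarrow>
      I1 \<subseteq> segments K0 L1 \<sigma> \<Longrightarrow> I2 \<subseteq> segments K0 L2 \<sigma> \<Longrightarrow>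
      separated_segments \<delta> I1 \<Longrightarrow> separated_segments \<delta> I2 \<Longrightarrow>
      real (card I1) * real (card I2) \<le>
        C * (L1 + L2 + c) * real (card (periodic_orbits_between \<phi> K (L1 + L2) (L1 + L2 + c)))"
proof -
  obtain b where b: "b > 0" "\<And>t x. dist x (\<phi> t x) \<le> b * \<bar>t\<bar>"
    using displacement by blast
  obtain r where r: "r > 0" "ball z0 r \<subseteq> K"
    using assms(3) by (auto simp: mem_interior)
  \<comment> \<open>Two points of one periodic orbit at parameter distance at most \<open>\<kappa>\<close> stay \<open>\<delta>/4\<close>-close at all times,
      and each is \<open>2 * \<epsilon>\<close>-close to the segments that it follows; in total this is less than \<open>\<delta>\<close>.\<close>
  define \<epsilon> \<kappa> where "\<epsilon> = min (\<delta> / 16) (r / 4)" and "\<kappa> = \<delta> / (4 * b)"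
  have \<epsilon>: "\<epsilon> > 0" "\<epsilon> \<le> \<delta> / 16" "3 * \<epsilon> < r" and \<kappa>: "\<kappa> > 0" "b * \<kappa> = \<delta> / 4"
    using assms(4) r(1) b(1) by (auto simp: \<epsilon>_def \<kappa>_def)
  define K0' where "K0' = insert z0 K0"
  have K0': "compact K0'" "z0 \<in> K0'" "K0 \<subseteq> K0'"
    using assms(1) by (auto simp: K0'_def)
  obtain \<eta> T where \<eta>: "\<eta> > 0" "T > 0" and
    glue: "\<And>p1 t1 u s2 v s3 p2 t2 x s5. {p1, \<phi> t1 p1, p2, \<phi> t2 p2} \<subseteq> K0' \<Longrightarrow>
      0 \<le> t1 \<Longrightarrow> T \<le> s2 \<Longrightarrow> 0 \<le> s3 \<Longrightarrow> 0 \<le> t2 \<Longrightarrow> 0 \<le> s5 \<Longrightarrow>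
      dist (\<phi> t1 p1) u < \<eta> \<Longrightarrow> dist (\<phi> s2 u) v < \<eta> \<Longrightarrow> dist v z0 < \<eta> \<Longrightarrow>
      dist (\<phi> s3 v) p2 < \<eta> \<Longrightarrow> dist (\<phi> t2 p2) x < \<eta> \<Longrightarrow> dist (\<phi> s5 x) p1 < \<eta> \<Longrightarrow>
      \<exists>z \<tau>. \<tau> \<in> {t1 + s2 + s3 + t2 + s5 - \<epsilon>..t1 + s2 + s3 + t2 + s5 + \<epsilon>} \<and> \<phi> \<tau> z = z \<and>
        (\<forall>s\<in>{0..t1}. dist (\<phi> s z) (\<phi> s p1) < 2 * \<epsilon>) \<and>
        (\<forall>s\<in>{0..t2}. dist (\<phi> (s + (t1 + s2 + s3)) z) (\<phi> s p2) < 2 * \<epsilon>) \<and>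
        dist (\<phi> (t1 + s2) z) z0 < 3 * \<epsilon>"
    using that by (rule periodic_orbit_through_segments[OF K0'(1,2) \<epsilon>(1)])
  obtain F where F: "finite F" "\<And>p. p \<in> K0' \<Longrightarrow> \<exists>q\<in>F. dist p q < \<eta> / 2"
    using compact_finite_net[OF K0'(1), of "\<eta> / 2"] \<eta>(1) by auto
  then obtain f where f: "\<And>p. p \<in> K0' \<Longrightarrow> f p \<in> F \<and> dist p (f p) < \<eta> / 2"
    by metis
  have "F \<noteq> {}"
    using f K0'(2) by blast
  \<comment> \<open>Connecting orbits between the centres of the net; their length at least \<open>\<epsilon>\<close> compensates the error
      in the period that the closing lemma allows.\<close>
  have "\<exists>us. snd us \<ge> T + \<epsilon> \<and> dist (fst us) q < \<eta> / 2 \<and> dist (\<phi> (snd us) (fst us)) q' < \<eta> / 2" for q q'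
    using connecting_segment[of "\<eta> / 2" "T + \<epsilon>" q q'] \<eta>(1) by auto
  then obtain us where us: "\<And>q q'. snd (us q q') \<ge> T + \<epsilon> \<and> dist (fst (us q q')) q < \<eta> / 2 \<and>
      dist (\<phi> (snd (us q q')) (fst (us q q'))) q' < \<eta> / 2"
    by metis
  define U S where "U q q' = fst (us q q')" and "S q q' = snd (us q q')" for q q'
  have S: "S q q' \<ge> T + \<epsilon>" and U: "dist (U q q') q < \<eta> / 2" "dist (\<phi> (S q q') (U q q')) q' < \<eta> / 2"
    for q q'
    using us by (auto simp: U_def S_def)
  define G where "G = insert z0 F"
  define smax where "smax = Max ((\<lambda>(q, q'). S q q') ` (G \<times> G))"
  have smax: "S q q' \<le> smax" if "q \<in> G" "q' \<in> G" for q q'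
    unfolding smax_def using that F(1) by (intro Max_ge) (auto simp: G_def)
  have "smax > 0"
    using smax[of z0 z0] S[of z0 z0] \<eta>(2) \<epsilon>(1) by (simp add: G_def)
  define c where "c = \<kappa> + 2 * \<sigma> + 3 * smax + \<epsilon>"
  have c: "c > 0" "c \<ge> \<kappa>"
    using \<kappa>(1) assms(5) \<open>smax > 0\<close> \<epsilon>(1) by (auto simp: c_def)
  define F4 where "F4 = F \<times> F \<times> F \<times> F"
  define C where "C = real (card F4) * (2 / \<kappa>)"
  have "card F4 > 0"
    using F(1) \<open>F \<noteq> {}\<close> by (simp add: F4_def card_gt_0_iff)
  then have C: "C > 0"
    using \<kappa>(1) by (simp add: C_def)
  have main: "real (card I1) * real (card I2) \<le>
      C * (L1 + L2 + c) * real (card (periodic_orbits_between \<phi> K (L1 + L2) (L1 + L2 + c)))"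
    if L: "L1 \<ge> 0" "L2 \<ge> 0" and I: "finite I1" "finite I2" "I1 \<subseteq> segments K0 L1 \<sigma>"
      "I2 \<subseteq> segments K0 L2 \<sigma>" and sep: "separated_segments \<delta> I1" "separated_segments \<delta> I2"
    for L1 L2 :: real and I1 I2
  proof -
    define P where "P = periodic_orbits_between \<phi> K (L1 + L2) (L1 + L2 + c)"
    have finP: "finite P"
      unfolding P_def by (rule finite_periodic_orbits[OF assms(2)])
    \<comment> \<open>Only pairs whose four end points lie near the same centres are glued, so that all of them use
        the same connecting orbits and the second segments start at comparable times.\<close>
    define h where "h = (\<lambda>((p1, t1), (p2, t2)). (f p1, f (\<phi> t1 p1), f p2, f (\<phi> t2 p2)))"
    have I1: "p \<in> K0'" "\<phi> t p \<in> K0'" "L1 \<le> t" "t \<le> L1 + \<sigma>" if "(p, t) \<in> I1" for p t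
      using segmentsD[of p t K0 L1 \<sigma>] that I(3) K0'(3) by auto
    have I2: "p \<in> K0'" "\<phi> t p \<in> K0'" "L2 \<le> t" "t \<le> L2 + \<sigma>" if "(p, t) \<in> I2" for p t
      using segmentsD[of p t K0 L2 \<sigma>] that I(4) K0'(3) by auto
    have "h ` (I1 \<times> I2) \<subseteq> F4"
      using f I1 I2 by (auto simp: h_def F4_def)
    then obtain e where e: "e \<in> F4" "card (I1 \<times> I2) \<le> card F4 * card {i \<in> I1 \<times> I2. h i = e}"
      using pigeonhole_fibre[of "I1 \<times> I2" F4 h] I(1,2) F(1) \<open>F \<noteq> {}\<close> by (auto simp: F4_def)
    obtain a1 b1 a2 b2 where abe: "e = (a1, b1, a2, b2)"
      by (metis surj_pair)
    define J where "J = {i \<in> I1 \<times> I2. h i = e}"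
    have G: "z0 \<in> G" "a1 \<in> G" "b1 \<in> G" "a2 \<in> G" "b2 \<in> G"
      using e(1) abe by (auto simp: F4_def G_def)
    define s2 s3 s5 where "s2 = S b1 z0" and "s3 = S z0 a2" and "s5 = S b2 a1"
    have s: "T + \<epsilon> \<le> s2" "T + \<epsilon> \<le> s3" "T + \<epsilon> \<le> s5" "s2 + s3 + s5 \<le> 3 * smax"
      using S smax[OF G(3,1)] smax[OF G(1,4)] smax[OF G(5,2)] by (auto simp: s2_def s3_def s5_def)
    have "\<exists>z\<tau>. (range (\<lambda>t. \<phi> t (fst z\<tau>)), snd z\<tau>) \<in> P \<and>
        (\<forall>s\<in>{0..t1}. dist (\<phi> s (fst z\<tau>)) (\<phi> s p1) < 2 * \<epsilon>) \<and>
        (\<forall>s\<in>{0..t2}. dist (\<phi> (s + (t1 + s2 + s3)) (fst z\<tau>)) (\<phi> s p2) < 2 * \<epsilon>)"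
      if J: "((p1, t1), (p2, t2)) \<in> J" for p1 t1 p2 t2
    proof -
      have i: "(p1, t1) \<in> I1" "(p2, t2) \<in> I2" and fe: "f p1 = a1" "f (\<phi> t1 p1) = b1" "f p2 = a2"
        "f (\<phi> t2 p2) = b2"
        using J abe by (auto simp: J_def h_def)
      note i1 = I1[OF i(1)] and i2 = I2[OF i(2)]
      have near: "dist p1 a1 < \<eta> / 2" "dist (\<phi> t1 p1) b1 < \<eta> / 2" "dist p2 a2 < \<eta> / 2"
        "dist (\<phi> t2 p2) b2 < \<eta> / 2"
        using f i1 i2 fe by blast+
      have gap: "dist q q' < \<eta>" if "dist q q'' < \<eta> / 2" "dist q'' q' < \<eta> / 2" for q q' q''
        using dist_triangle[of q q' q''] that by linarith
      have near0: "dist (U z0 a2) z0 < \<eta>"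
        using U(1)[of z0 a2] \<eta>(1) by linarith
      have "\<exists>z \<tau>. \<tau> \<in> {t1 + s2 + s3 + t2 + s5 - \<epsilon>..t1 + s2 + s3 + t2 + s5 + \<epsilon>} \<and> \<phi> \<tau> z = z \<and>
        (\<forall>s\<in>{0..t1}. dist (\<phi> s z) (\<phi> s p1) < 2 * \<epsilon>) \<and>
        (\<forall>s\<in>{0..t2}. dist (\<phi> (s + (t1 + s2 + s3)) z) (\<phi> s p2) < 2 * \<epsilon>) \<and>
        dist (\<phi> (t1 + s2) z) z0 < 3 * \<epsilon>"
      proof (rule glue[where u = "U b1 z0" and v = "U z0 a2" and x = "U b2 a1"])
        show "dist (\<phi> t1 p1) (U b1 z0) < \<eta>"
          using gap[OF near(2)] U(1)[of b1 z0] by (simp add: dist_commute)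
        show "dist (\<phi> s2 (U b1 z0)) (U z0 a2) < \<eta>"
          using gap[OF U(2)[of b1 z0]] U(1)[of z0 a2] by (simp add: dist_commute s2_def)
        show "dist (\<phi> s3 (U z0 a2)) p2 < \<eta>"
          using gap[OF U(2)[of z0 a2]] near(3) by (simp add: dist_commute s3_def)
        show "dist (\<phi> t2 p2) (U b2 a1) < \<eta>"
          using gap[OF near(4)] U(1)[of b2 a1] by (simp add: dist_commute)
        show "dist (\<phi> s5 (U b2 a1)) p1 < \<eta>"
          using gap[OF U(2)[of b2 a1]] near(1) by (simp add: dist_commute s5_def)
      qed (use near0 i1 i2 s L \<eta>(2) \<epsilon>(1) in auto)
      then obtain z \<tau> where z: "\<tau> \<in> {t1 + s2 + s3 + t2 + s5 - \<epsilon>..t1 + s2 + s3 + t2 + s5 + \<epsilon>}"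
        "\<phi> \<tau> z = z" "\<forall>s\<in>{0..t1}. dist (\<phi> s z) (\<phi> s p1) < 2 * \<epsilon>"
        "\<forall>s\<in>{0..t2}. dist (\<phi> (s + (t1 + s2 + s3)) z) (\<phi> s p2) < 2 * \<epsilon>"
        "dist (\<phi> (t1 + s2) z) z0 < 3 * \<epsilon>"
        by (elim exE conjE) (rule that)
      have \<tau>: "0 < \<tau>" "L1 + L2 \<le> \<tau>" "\<tau> \<le> L1 + L2 + c"
        using z(1) i1(3,4) i2(3,4) s L \<eta>(2) \<epsilon>(1) \<kappa>(1) by (auto simp: c_def)
      have "\<phi> (t1 + s2) z \<in> K"
        using z(5) \<epsilon>(3) r(2) by (auto simp: dist_commute)
      then have "range (\<lambda>t. \<phi> t z) \<inter> K \<noteq> {}"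
        by blast
      moreover have "(range (\<lambda>t. \<phi> t z), \<tau>) \<in> periodic_orbits \<phi>"
        using z(2) \<tau>(1) unfolding periodic_orbits_def by auto
      ultimately have "(range (\<lambda>t. \<phi> t z), \<tau>) \<in> P"
        using \<tau> by (simp add: P_def periodic_orbits_between_def)
      then show ?thesis
        using z(3,4) by (intro exI[of _ "(z, \<tau>)"]) simp
    qed
    then have "\<forall>j\<in>J. \<exists>z\<tau>. (range (\<lambda>t. \<phi> t (fst z\<tau>)), snd z\<tau>) \<in> P \<and>
        (\<forall>s\<in>{0..snd (fst j)}. dist (\<phi> s (fst z\<tau>)) (\<phi> s (fst (fst j))) < 2 * \<epsilon>) \<and>
        (\<forall>s\<in>{0..snd (snd j)}. dist (\<phi> (s + (snd (fst j) + s2 + s3)) (fst z\<tau>))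
            (\<phi> s (fst (snd j))) < 2 * \<epsilon>)"
      by auto
    from bchoice[OF this] obtain Z where Z: "\<forall>j\<in>J. (range (\<lambda>t. \<phi> t (fst (Z j))), snd (Z j)) \<in> P \<and>
        (\<forall>s\<in>{0..snd (fst j)}. dist (\<phi> s (fst (Z j))) (\<phi> s (fst (fst j))) < 2 * \<epsilon>) \<and>
        (\<forall>s\<in>{0..snd (snd j)}. dist (\<phi> (s + (snd (fst j) + s2 + s3)) (fst (Z j)))
            (\<phi> s (fst (snd j))) < 2 * \<epsilon>)"
      by (elim exE)
    define orb where "orb j = (range (\<lambda>t. \<phi> t (fst (Z j))), snd (Z j))" for j
    have orb: "orb j \<in> P" if "j \<in> J" for j
      using Z that by (simp add: orb_def)
    have orbP: "(\<gamma>, \<tau>) \<in> periodic_orbits \<phi>" "\<tau> \<le> L1 + L2 + c" if "(\<gamma>, \<tau>) \<in> P" for \<gamma> \<tau>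
      using that by (auto simp: P_def periodic_orbits_between_def)
    define base where "base \<gamma> = (SOME p. p \<in> \<gamma>)" for \<gamma> :: "'a set"
    have "\<exists>\<theta>\<in>{0..snd (Z j)}. fst (Z j) = \<phi> \<theta> (base (fst (orb j)))" if "j \<in> J" for j
    proof -
      have z: "fst (Z j) \<in> fst (orb j)"
        by (simp add: orb_def) (metis flow_zero rangeI)
      then have "base (fst (orb j)) \<in> fst (orb j)"
        unfolding base_def by (rule someI)
      moreover have "(fst (orb j), snd (Z j)) \<in> periodic_orbits \<phi>"
        using orbP(1)[of "fst (orb j)" "snd (Z j)"] orb[OF that] by (simp add: orb_def)
      ultimately show ?thesis
        using periodic_orbit_parameter z by blast
    qed
    then obtain \<theta> where \<theta>: "\<And>j. j \<in> J \<Longrightarrow> \<theta> j \<in> {0..snd (Z j)}"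
        "\<And>j. j \<in> J \<Longrightarrow> fst (Z j) = \<phi> (\<theta> j) (base (fst (orb j)))"
      by metis
    define m where "m = nat \<lfloor>(L1 + L2 + c) / \<kappa>\<rfloor>"
    define H where "H j = (orb j, nat \<lfloor>\<theta> j / \<kappa>\<rfloor>)" for j
    have "H ` J \<subseteq> P \<times> {..m}"
    proof (rule image_subsetI)
      fix j assume j: "j \<in> J"
      have "snd (Z j) \<le> L1 + L2 + c"
        using orbP(2)[of "fst (orb j)" "snd (Z j)"] orb[OF j] by (simp add: orb_def)
      then have "\<theta> j \<le> L1 + L2 + c"
        using \<theta>(1)[OF j] by auto
      then have "nat \<lfloor>\<theta> j / \<kappa>\<rfloor> \<le> m"
        unfolding m_def using \<kappa>(1) by (intro nat_mono floor_mono divide_right_mono) auto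
      then show "H j \<in> P \<times> {..m}"
        using orb[OF j] by (simp add: H_def)
    qed
    moreover have "inj_on H J"
    proof (rule inj_onI)
      fix j j' assume j: "j \<in> J" "j' \<in> J" "H j = H j'"
      obtain p1 t1 p2 t2 where jeq: "j = ((p1, t1), (p2, t2))"
        by (metis surj_pair)
      obtain p1' t1' p2' t2' where jeq': "j' = ((p1', t1'), (p2', t2'))"
        by (metis surj_pair)
      have mem: "(p1, t1) \<in> I1" "(p2, t2) \<in> I2" "(p1', t1') \<in> I1" "(p2', t2') \<in> I2"
        using j(1,2) by (auto simp: jeq jeq' J_def)
      have pos: "0 \<le> \<theta> j / \<kappa>" "0 \<le> \<theta> j' / \<kappa>"
        using \<theta>(1)[OF j(1)] \<theta>(1)[OF j(2)] \<kappa>(1) by auto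
      have "\<lfloor>\<theta> j / \<kappa>\<rfloor> = \<lfloor>\<theta> j' / \<kappa>\<rfloor>"
        using j(3) pos by (simp add: H_def eq_nat_nat_iff)
      then have "\<bar>\<theta> j / \<kappa> - \<theta> j' / \<kappa>\<bar> \<le> 1"
        by linarith
      then have th: "\<bar>\<theta> j - \<theta> j'\<bar> \<le> \<kappa>"
        using \<kappa>(1) by (simp add: abs_le_iff field_simps)
      have zz: "dist (\<phi> s (fst (Z j))) (\<phi> s (fst (Z j'))) \<le> \<delta> / 4" for s
      proof -
        let ?p = "\<phi> (s + \<theta> j') (base (fst (orb j)))"
        have "orb j = orb j'"
          using j(3) by (simp add: H_def)
        then have "\<phi> s (fst (Z j')) = ?p" "\<phi> s (fst (Z j)) = \<phi> (\<theta> j - \<theta> j') ?p"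
          using \<theta>(2)[OF j(1)] \<theta>(2)[OF j(2)] flow_add[of "\<theta> j - \<theta> j'" "s + \<theta> j'"]
            flow_add[of s "\<theta> j'"] flow_add[of s "\<theta> j"] by (auto simp: add_ac)
        then have "dist (\<phi> s (fst (Z j'))) (\<phi> s (fst (Z j))) \<le> b * \<bar>\<theta> j - \<theta> j'\<bar>"
          using b(2)[of ?p "\<theta> j - \<theta> j'"] by simp
        also have "\<dots> \<le> b * \<kappa>"
          using th b(1) by simp
        finally show ?thesis
          using \<kappa>(2) by (simp add: dist_commute)
      qed
      have close: "dist q q' < \<delta>"
        if "dist (\<phi> s (fst (Z j))) q < 2 * \<epsilon>" "dist (\<phi> s (fst (Z j'))) q' < 2 * \<epsilon>" for s q q'
      proof -
        have "dist q q' \<le> dist q (\<phi> s (fst (Z j))) + dist (\<phi> s (fst (Z j))) (\<phi> s (fst (Z j')))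
            + dist (\<phi> s (fst (Z j'))) q'"
          by (rule dist_triangle_three)
        then show ?thesis
          using that zz[of s] \<epsilon>(2) assms(4) by (simp add: dist_commute)
      qed
      have Zj: "s \<in> {0..t1} \<Longrightarrow> dist (\<phi> s (fst (Z j))) (\<phi> s p1) < 2 * \<epsilon>"
        "s \<in> {0..t2} \<Longrightarrow> dist (\<phi> (s + (t1 + s2 + s3)) (fst (Z j))) (\<phi> s p2) < 2 * \<epsilon>"
        "s \<in> {0..t1'} \<Longrightarrow> dist (\<phi> s (fst (Z j'))) (\<phi> s p1') < 2 * \<epsilon>"
        "s \<in> {0..t2'} \<Longrightarrow> dist (\<phi> (s + (t1' + s2 + s3)) (fst (Z j'))) (\<phi> s p2') < 2 * \<epsilon>" for s
        using bspec[OF Z j(1)] bspec[OF Z j(2)] unfolding jeq jeq' by auto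
      have eq1: "(p1, t1) = (p1', t1')"
      proof (rule ccontr)
        assume "\<not> ?thesis"
        then obtain u where "u \<in> {0..min t1 t1'}" "\<delta> \<le> dist (\<phi> u p1) (\<phi> u p1')"
          using separated_segmentsD[OF sep(1) mem(1,3)] by blast
        then show False
          using close[OF Zj(1)[of u] Zj(3)[of u]] by auto
      qed
      moreover have "(p2, t2) = (p2', t2')"
      proof (rule ccontr)
        assume "\<not> ?thesis"
        then obtain u where "u \<in> {0..min t2 t2'}" "\<delta> \<le> dist (\<phi> u p2) (\<phi> u p2')"
          using separated_segmentsD[OF sep(2) mem(2,4)] by blast
        then show False
          using close[OF Zj(2)[of u], of "\<phi> u p2'"] Zj(4)[of u] eq1 by auto
      qed
      ultimately show "j = j'"
        by (simp add: jeq jeq')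
    qed
    ultimately have "card J \<le> card (P \<times> {..m})"
      using finP by (intro card_inj_on_le) auto
    then have cJ: "card J \<le> card P * Suc m"
      by (simp add: card_cartesian_product)
    have m1: "real (Suc m) \<le> 2 / \<kappa> * (L1 + L2 + c)"
    proof -
      have "real m \<le> (L1 + L2 + c) / \<kappa>"
        using L c(1) \<kappa>(1) by (simp add: m_def)
      moreover have "1 \<le> (L1 + L2 + c) / \<kappa>"
        using L c(2) \<kappa>(1) by simp
      moreover have "2 / \<kappa> * (L1 + L2 + c) = (L1 + L2 + c) / \<kappa> + (L1 + L2 + c) / \<kappa>"
        by (simp add: field_simps)
      ultimately show ?thesis
        unfolding of_nat_Suc by linarith
    qed
    have "real (card I1) * real (card I2) = real (card (I1 \<times> I2))"
      by (simp add: card_cartesian_product)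
    also have "\<dots> \<le> real (card F4) * real (card J)"
      using e(2) unfolding J_def of_nat_mult[symmetric] of_nat_le_iff .
    also have "\<dots> \<le> real (card F4) * (real (card P) * real (Suc m))"
      using cJ unfolding of_nat_mult[symmetric] of_nat_le_iff by (rule mult_le_mono2)
    also have "\<dots> \<le> real (card F4) * (real (card P) * (2 / \<kappa> * (L1 + L2 + c)))"
      using m1 by (intro mult_left_mono) auto
    also have "\<dots> = C * (L1 + L2 + c) * real (card P)"
      by (simp add: C_def)
    finally show ?thesis
      unfolding P_def .
  qed
  show thesis
    by (rule that[OF C c(1) main])
qed

text \<open>A separated family of segments is turned into a separated set of chords from \<open>x\<close> to \<open>y\<close>. Before
  reaching \<open>y\<close>, the chords run \<open>j\<close> times along a given periodic orbit of period \<open>\<tau>0\<close>; as \<open>j\<close> is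
  arbitrary, so is the length of the chords up to an error of \<open>\<tau>0\<close>.\<close>

lemma segments_to_chords:
  assumes "compact K0" "\<phi> \<tau>0 p0 = p0" "\<tau>0 > 0" "\<eta> > 0" "\<delta> < \<alpha>" "0 < \<delta>" "w \<ge> 0"
  obtains C :: nat and c :: real where "C > 0" "c > 0"
    "\<And>L I. 0 \<le> L \<Longrightarrow> finite I \<Longrightarrow> I \<subseteq> segments K0 L w \<Longrightarrow> separated_segments \<alpha> I \<Longrightarrow>
      \<exists>S\<in>{0..c}. \<forall>(j::nat) T \<tau>. L + S \<le> T \<and> T \<le> L + S + real j * \<tau>0 \<and>
          L + S + real j * \<tau>0 + w \<le> T + \<tau> \<longrightarrow>
        (\<exists>W. W \<subseteq> chords \<phi> x y \<eta> T (T + \<tau>) \<and> separating \<phi> \<delta> T W \<and> card I \<le> C * card W)"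
proof -
  define \<epsilon> where "\<epsilon> = min ((\<alpha> - \<delta>) / 2) (\<eta> / 2)"
  have \<epsilon>: "\<epsilon> > 0" "\<epsilon> \<le> (\<alpha> - \<delta>) / 2" "\<epsilon> \<le> \<eta> / 2"
    unfolding \<epsilon>_def using assms by (simp, intro min.cobounded1, intro min.cobounded2)
  define K0' where "K0' = insert x (insert p0 K0)"
  have K0': "compact K0'" "x \<in> K0'" "p0 \<in> K0'" "K0 \<subseteq> K0'"
    using assms(1) by (auto simp: K0'_def)
  obtain r K1 where r: "r > 0" "compact K1" "\<And>q. q \<in> K0' \<Longrightarrow> ball q r \<subseteq> K1"
    using compact_neighbourhood[OF K0'(1) locally_compact] by blast
  obtain \<eta>0 where \<eta>0: "\<eta>0 > 0" and
    sh: "\<And>x1 x2 x3 x4 x5 t1 t2 t3 t4 t5. {x1, x2, x3, x4, x5} \<subseteq> K1 \<Longrightarrow>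
      0 \<le> t1 \<Longrightarrow> 0 \<le> t2 \<Longrightarrow> 0 \<le> t3 \<Longrightarrow> 0 \<le> t4 \<Longrightarrow> 0 \<le> t5 \<Longrightarrow>
      dist (\<phi> t1 x1) x2 < \<eta>0 \<Longrightarrow> dist (\<phi> t2 x2) x3 < \<eta>0 \<Longrightarrow>
      dist (\<phi> t3 x3) x4 < \<eta>0 \<Longrightarrow> dist (\<phi> t4 x4) x5 < \<eta>0 \<Longrightarrow>
      \<exists>y. (\<forall>s\<in>{0..t1}. dist (\<phi> s y) (\<phi> s x1) < \<epsilon>) \<and>
         (\<forall>s\<in>{0..t2}. dist (\<phi> (s + t1) y) (\<phi> s x2) < \<epsilon>) \<and>
         (\<forall>s\<in>{0..t3}. dist (\<phi> (s + (t1 + t2)) y) (\<phi> s x3) < \<epsilon>) \<and>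
         (\<forall>s\<in>{0..t4}. dist (\<phi> (s + (t1 + t2 + t3)) y) (\<phi> s x4) < \<epsilon>) \<and>
         (\<forall>s\<in>{0..t5}. dist (\<phi> (s + (t1 + t2 + t3 + t4)) y) (\<phi> s x5) < \<epsilon>)"
    using that by (rule five_piece_shadowing[OF r(2) \<epsilon>(1)])
  define \<eta>' where "\<eta>' = Min {\<eta>0, r, \<eta>} / 2"
  have "Min {\<eta>0, r, \<eta>} > 0"
    using \<eta>0 r(1) assms(4) by simp
  then have \<eta>': "\<eta>' > 0" "2 * \<eta>' \<le> \<eta>0" "2 * \<eta>' \<le> r" "\<eta>' \<le> \<eta> / 2"
    by (auto simp: \<eta>'_def)
  obtain F where F: "finite F" "F \<subseteq> K0'" "\<And>p. p \<in> K0' \<Longrightarrow> \<exists>q\<in>F. dist p q < \<eta>'"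
    using compact_finite_net[OF K0'(1) \<eta>'(1)] by auto
  then obtain f where f: "\<And>p. p \<in> K0' \<Longrightarrow> f p \<in> F \<and> dist p (f p) < \<eta>'"
    by metis
  have "F \<noteq> {}"
    using f K0'(2) by blast
  \<comment> \<open>With connecting orbits of length at least \<open>w\<close>, the segments, of length at most \<open>L + w\<close>, have been
      followed to their ends by time \<open>T\<close>, so that the chords are separated before \<open>T\<close>.\<close>
  have "\<exists>us. snd us \<ge> w \<and> dist (fst us) q < \<eta>' \<and> dist (\<phi> (snd us) (fst us)) q' < \<eta>'" for q q'
    using connecting_segment[OF \<eta>'(1), of w q q'] by auto
  then obtain us where us: "\<And>q q'. snd (us q q') \<ge> w \<and> dist (fst (us q q')) q < \<eta>' \<and>
      dist (\<phi> (snd (us q q')) (fst (us q q'))) q' < \<eta>'"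
    by metis
  define U S where "U q q' = fst (us q q')" and "S q q' = snd (us q q')" for q q'
  have S: "S q q' \<ge> w" and U: "dist (U q q') q < \<eta>'" "dist (\<phi> (S q q') (U q q')) q' < \<eta>'" for q q'
    using us by (auto simp: U_def S_def)
  define smax where "smax = 1 + Max ((\<lambda>(a, b). S x a + S b p0 + S p0 y) ` (F \<times> F))"
  have smax: "S x a + S b p0 + S p0 y \<le> smax" if "a \<in> F" "b \<in> F" for a b
  proof -
    have "(\<lambda>(a, b). S x a + S b p0 + S p0 y) (a, b) \<le> Max ((\<lambda>(a, b). S x a + S b p0 + S p0 y) ` (F \<times> F))"
      using that F(1) by (intro Max_ge) auto
    then show ?thesis
      by (simp add: smax_def)
  qed
  have "smax > 0"
  proof -
    obtain a where a: "a \<in> F"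
      using \<open>F \<noteq> {}\<close> by blast
    have "(\<lambda>(a, b). S x a + S b p0 + S p0 y) (a, a) \<le> Max ((\<lambda>(a, b). S x a + S b p0 + S p0 y) ` (F \<times> F))"
      using a F(1) by (intro Max_ge) auto
    then show ?thesis
      using S[of x a] S[of a p0] S[of p0 y] assms(7) by (simp add: smax_def)
  qed
  have main: "\<exists>S\<in>{0..smax}. \<forall>(j::nat) T \<tau>. L + S \<le> T \<and> T \<le> L + S + real j * \<tau>0 \<and>
        L + S + real j * \<tau>0 + w \<le> T + \<tau> \<longrightarrow>
      (\<exists>W. W \<subseteq> chords \<phi> x y \<eta> T (T + \<tau>) \<and> separating \<phi> \<delta> T W \<and> card I \<le> card (F \<times> F) * card W)"
    if L: "L \<ge> 0" and I: "finite I" "I \<subseteq> segments K0 L w" and sep: "separated_segments \<alpha> I" for L I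
  proof -
    define h where "h = (\<lambda>(p, t). (f p, f (\<phi> t p)))"
    have I': "p \<in> K0'" "\<phi> t p \<in> K0'" "L \<le> t" "t \<le> L + w" if "(p, t) \<in> I" for p t
      using segmentsD[of p t K0 L w] that I(2) K0'(4) by auto
    have "h ` I \<subseteq> F \<times> F"
      using f I' by (auto simp: h_def)
    then obtain e where e: "e \<in> F \<times> F" "card I \<le> card (F \<times> F) * card {i \<in> I. h i = e}"
      using pigeonhole_fibre[of I "F \<times> F" h] I(1) F(1) \<open>F \<noteq> {}\<close> by auto
    obtain a b where ab: "e = (a, b)"
      by (metis surj_pair)
    have abF: "a \<in> F" "b \<in> F"
      using e(1) ab by auto
    define J where "J = {i \<in> I. h i = e}"
    define s1 s3 s5 where "s1 = S x a" and "s3 = S b p0" and "s5 = S p0 y"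
    have s: "w \<le> s1" "w \<le> s3" "w \<le> s5" "s1 + s3 + s5 \<le> smax"
      using S smax[OF abF] by (auto simp: s1_def s3_def s5_def)
    have "\<exists>W. W \<subseteq> chords \<phi> x y \<eta> T (T + \<tau>) \<and> separating \<phi> \<delta> T W \<and> card I \<le> card (F \<times> F) * card W"
      if T: "L + (s1 + s3 + s5) \<le> T" "T \<le> L + (s1 + s3 + s5) + real j * \<tau>0"
        "L + (s1 + s3 + s5) + real j * \<tau>0 + w \<le> T + \<tau>" for j :: nat and T \<tau>
    proof -
      have loop: "\<phi> (real j * \<tau>0) p0 = p0"
        using flow_periodic_int[OF assms(2), of "int j"] by simp
      have "\<exists>z. z \<in> chords \<phi> x y \<eta> T (T + \<tau>) \<and>
          (\<forall>s\<in>{0..t}. dist (\<phi> (s + s1) z) (\<phi> s p) < \<epsilon>)" if pt: "(p, t) \<in> J" for p t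
      proof -
        have i: "(p, t) \<in> I" and fe: "f p = a" "f (\<phi> t p) = b"
          using pt ab by (auto simp: J_def h_def)
        note i' = I'[OF i]
        have near: "dist p a < \<eta>'" "dist (\<phi> t p) b < \<eta>'"
          using f i' fe by blast+
        have gap: "dist q q' < \<eta>0" if "dist q q'' < \<eta>'" "dist q'' q' < \<eta>'" for q q' q''
          using dist_triangle[of q q' q''] that \<eta>'(2) by linarith
        have K1: "q \<in> K1" if "q' \<in> K0'" "dist q q' < \<eta>'" for q q'
          using r(3)[OF that(1)] that(2) \<eta>'(1,3) by (auto simp: dist_commute)
        have inK1: "{U x a, p, U b p0, p0, U p0 y} \<subseteq> K1"
          using K1[OF K0'(2) U(1)] K1[OF i'(1), of p] K1[OF _ U(1), of b] K1[OF K0'(3), of p0]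
            K1[OF K0'(3) U(1)] \<eta>'(1) abF F(2) by auto
        have "\<exists>z. (\<forall>s\<in>{0..s1}. dist (\<phi> s z) (\<phi> s (U x a)) < \<epsilon>) \<and>
           (\<forall>s\<in>{0..t}. dist (\<phi> (s + s1) z) (\<phi> s p) < \<epsilon>) \<and>
           (\<forall>s\<in>{0..s3}. dist (\<phi> (s + (s1 + t)) z) (\<phi> s (U b p0)) < \<epsilon>) \<and>
           (\<forall>s\<in>{0..real j * \<tau>0}. dist (\<phi> (s + (s1 + t + s3)) z) (\<phi> s p0) < \<epsilon>) \<and>
           (\<forall>s\<in>{0..s5}. dist (\<phi> (s + (s1 + t + s3 + real j * \<tau>0)) z) (\<phi> s (U p0 y)) < \<epsilon>)"
        proof (rule sh[OF inK1])
          show "dist (\<phi> s1 (U x a)) p < \<eta>0"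
            using gap[OF U(2)[of x a]] near(1) by (simp add: dist_commute s1_def)
          show "dist (\<phi> t p) (U b p0) < \<eta>0"
            using gap[OF near(2)] U(1)[of b p0] by (simp add: dist_commute)
          show "dist (\<phi> s3 (U b p0)) p0 < \<eta>0"
            using gap[OF U(2)[of b p0], of p0] \<eta>'(1) by (simp add: s3_def)
          show "dist (\<phi> (real j * \<tau>0) p0) (U p0 y) < \<eta>0"
            using gap[of p0 p0 "U p0 y"] U(1)[of p0 y] \<eta>'(1) loop by (simp add: dist_commute)
        qed (use i' s L assms(3,7) in auto)
        then obtain z where z: "\<forall>s\<in>{0..s1}. dist (\<phi> s z) (\<phi> s (U x a)) < \<epsilon>"
           "\<forall>s\<in>{0..t}. dist (\<phi> (s + s1) z) (\<phi> s p) < \<epsilon>"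
           "\<forall>s\<in>{0..s5}. dist (\<phi> (s + (s1 + t + s3 + real j * \<tau>0)) z) (\<phi> s (U p0 y)) < \<epsilon>"
          by (elim exE conjE) (rule that)
        have "dist z (U x a) < \<epsilon>"
          using z(1)[rule_format, of 0] s assms(7) by simp
        then have "z \<in> ball x \<eta>"
          using dist_triangle[of z x "U x a"] U(1)[of x a] \<eta>'(4) \<epsilon>(3) by (simp add: dist_commute)
        moreover define t' where "t' = s5 + (s1 + t + s3 + real j * \<tau>0)"
        have "dist (\<phi> t' z) (\<phi> s5 (U p0 y)) < \<epsilon>"
          using z(3)[rule_format, of s5] s assms(7) by (simp add: t'_def)
        then have "\<phi> t' z \<in> ball y \<eta>"
          using dist_triangle[of "\<phi> t' z" y "\<phi> s5 (U p0 y)"] U(2)[of p0 y] \<eta>'(4) \<epsilon>(3)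
          by (simp add: dist_commute s5_def)
        moreover have "t' \<in> {T..T + \<tau>}"
          using T i'(3,4) by (simp add: t'_def)
        ultimately have "z \<in> chords \<phi> x y \<eta> T (T + \<tau>)"
          unfolding chords_def by blast
        then show ?thesis
          using z(2) by blast
      qed
      then have "\<forall>i\<in>J. \<exists>z. z \<in> chords \<phi> x y \<eta> T (T + \<tau>) \<and>
          (\<forall>s\<in>{0..snd i}. dist (\<phi> (s + s1) z) (\<phi> s (fst i)) < \<epsilon>)"
        by auto
      from bchoice[OF this] obtain Z where Z: "\<forall>i\<in>J. Z i \<in> chords \<phi> x y \<eta> T (T + \<tau>) \<and>
          (\<forall>s\<in>{0..snd i}. dist (\<phi> (s + s1) (Z i)) (\<phi> s (fst i)) < \<epsilon>)"
        by (elim exE)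
      have far: "\<exists>u\<in>{0..T}. \<delta> \<le> dist (\<phi> u (Z i)) (\<phi> u (Z i'))"
        if i: "i \<in> J" "i' \<in> J" "i \<noteq> i'" for i i'
      proof -
        obtain p t p' t' where eq: "i = (p, t)" "i' = (p', t')"
          by (metis surj_pair)
        have mem: "(p, t) \<in> I" "(p', t') \<in> I" "(p, t) \<noteq> (p', t')"
          using i by (auto simp: eq J_def)
        obtain u where u: "u \<in> {0..min t t'}" "\<alpha> \<le> dist (\<phi> u p) (\<phi> u p')"
          using separated_segmentsD[OF sep mem] by blast
        have "dist (\<phi> (u + s1) (Z i)) (\<phi> u p) < \<epsilon>" "dist (\<phi> (u + s1) (Z i')) (\<phi> u p') < \<epsilon>"
          using bspec[OF Z i(1)] bspec[OF Z i(2)] u(1) unfolding eq by auto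
        moreover have "dist (\<phi> u p) (\<phi> u p') \<le> dist (\<phi> u p) (\<phi> (u + s1) (Z i)) +
            dist (\<phi> (u + s1) (Z i)) (\<phi> (u + s1) (Z i')) + dist (\<phi> (u + s1) (Z i')) (\<phi> u p')"
          by (rule dist_triangle_three)
        ultimately have "\<delta> \<le> dist (\<phi> (u + s1) (Z i)) (\<phi> (u + s1) (Z i'))"
          using u(2) \<epsilon>(2) by (simp add: dist_commute)
        moreover have "u + s1 \<in> {0..T}"
          using u(1) I'(3,4)[OF mem(1)] T(1) s assms(7) by auto
        ultimately show ?thesis
          by blast
      qed
      have "inj_on Z J"
        using far assms(6) by (fastforce simp: inj_on_def)
      then have "card (Z ` J) = card J"
        by (rule card_image)
      moreover have "Z ` J \<subseteq> chords \<phi> x y \<eta> T (T + \<tau>)"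
        using Z by auto
      moreover have "separating \<phi> \<delta> T (Z ` J)"
        unfolding separating_def
      proof (intro ballI impI)
        fix p q assume "p \<in> Z ` J" "q \<in> Z ` J" "p \<noteq> q"
        then obtain i i' where "i \<in> J" "i' \<in> J" "p = Z i" "q = Z i'" "i \<noteq> i'"
          by blast
        then show "\<exists>t\<in>{0..T}. \<delta> \<le> dist (\<phi> t p) (\<phi> t q)"
          using far by simp
      qed
      ultimately show ?thesis
        using e(2) unfolding J_def by (intro exI[of _ "Z ` J"]) (simp add: J_def)
    qed
    moreover have "s1 + s3 + s5 \<in> {0..smax}"
      using s assms(7) by auto
    ultimately show ?thesis
      by blast
  qed
  have "card (F \<times> F) > 0"
    using F(1) \<open>F \<noteq> {}\<close> by (simp add: card_gt_0_iff)
  then show thesis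
    by (rule that[OF _ \<open>smax > 0\<close> main])
qed

end

section \<open>Exponential growth rates\<close>

lemma elog_over_ereal:
  assumes "L > 0"
  shows "elog (enat n) / ereal L = (if n = 0 then -\<infinity> else ereal (ln (real n) / L))"
  using assms by (simp add: elog_def)

text \<open>Bounded shifts of the argument and linear factors do not change the growth rate.\<close>

lemma Limsup_elog_le:
  fixes f g :: "real \<Rightarrow> nat"
  assumes "C > 0" "c \<ge> 0"
    and le: "\<And>L. L > 0 \<Longrightarrow> \<exists>T\<in>{L..L + c}. real (f L) \<le> C * (L + c) * real (g T)"
  shows "Limsup at_top (\<lambda>L. elog (enat (f L)) / ereal L) \<le>
    Limsup at_top (\<lambda>T. elog (enat (g T)) / ereal T)"
proof (rule dense_ge)
  fix y assume y: "Limsup at_top (\<lambda>T. elog (enat (g T)) / ereal T) < y"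
  show "Limsup at_top (\<lambda>L. elog (enat (f L)) / ereal L) \<le> y"
  proof (cases y)
    case (real r)
    then have "eventually (\<lambda>T. elog (enat (g T)) / ereal T < ereal r) at_top"
      using y Limsup_lessD by blast
    then obtain T0 where T0: "\<And>T. T \<ge> T0 \<Longrightarrow> elog (enat (g T)) / ereal T < ereal r"
      by (auto simp: eventually_at_top_linorder)
    have "eventually (\<lambda>L. elog (enat (f L)) / ereal L \<le>
        ereal ((ln C + ln (L + c) + \<bar>r\<bar> * c) / L + r)) at_top"
      using eventually_gt_at_top[of "max 0 T0"]
    proof eventually_elim
      case (elim L)
      then have L: "L > 0" "L \<ge> T0" by auto
      obtain T where T: "T \<in> {L..L + c}" "real (f L) \<le> C * (L + c) * real (g T)"
        using le[OF L(1)] by blast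
      have gT: "elog (enat (g T)) / ereal T < ereal r"
        using T0 T(1) L(2) by auto
      show ?case
      proof (cases "f L = 0")
        case True
        then show ?thesis
          using L(1) by (simp add: elog_over_ereal)
      next
        case False
        then have g: "g T \<noteq> 0"
          using T(2) by (cases "g T = 0") auto
        have "T > 0"
          using T(1) L(1) by auto
        with gT g have "ln (real (g T)) < r * T"
          by (simp add: elog_over_ereal field_simps)
        moreover have "r * T \<le> r * L + \<bar>r\<bar> * c"
        proof -
          have "r * (T - L) \<le> \<bar>r\<bar> * (T - L)"
            using T(1) by (intro mult_right_mono) auto
          also have "\<dots> \<le> \<bar>r\<bar> * c"
            using T(1) by (intro mult_left_mono) auto
          finally show ?thesis
            by (simp add: algebra_simps)
        qed
        moreover have "ln (real (f L)) \<le> ln (C * (L + c) * real (g T))"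
          using T(2) False by (simp add: ln_mono)
        moreover have "ln (C * (L + c) * real (g T)) = ln C + ln (L + c) + ln (real (g T))"
          using assms(1,2) L(1) g by (simp add: ln_mult)
        ultimately have "ln (real (f L)) \<le> ln C + ln (L + c) + \<bar>r\<bar> * c + r * L"
          by linarith
        then have "ln (real (f L)) / L \<le> (ln C + ln (L + c) + \<bar>r\<bar> * c + r * L) / L"
          using L(1) by (simp add: divide_right_mono)
        then show ?thesis
          using L(1) False by (simp add: elog_over_ereal add_divide_distrib)
      qed
    qed
    then have "Limsup at_top (\<lambda>L. elog (enat (f L)) / ereal L) \<le>
        Limsup at_top (\<lambda>L. ereal ((ln C + ln (L + c) + \<bar>r\<bar> * c) / L + r))"
      by (rule Limsup_mono)
    also have "\<dots> = ereal r"
    proof (rule lim_imp_Limsup)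
      have "((\<lambda>L. (ln C + ln (L + c) + \<bar>r\<bar> * c) / L + r) \<longlongrightarrow> r) at_top"
        by real_asymp
      then show "((\<lambda>L. ereal ((ln C + ln (L + c) + \<bar>r\<bar> * c) / L + r)) \<longlongrightarrow> ereal r) at_top"
        by simp
    qed simp
    finally show ?thesis
      using real by simp
  qed (use y in auto)
qed

text \<open>A function that is supermultiplicative up to a linear factor and a bounded shift of the
  argument grows at least geometrically along a sequence with bounded gaps. The integer \<open>m\<close> is halved
  in each step, so that the linear losses multiply up to a factor \<open>B ^ m\<close> only, whereas splitting
  off one summand at a time would produce a factorial.\<close>

lemma supermultiplicative_iterate:
  fixes p :: "real \<Rightarrow> real"
  assumes nonneg: "\<And>L. p L \<ge> 0" and "C > 0" "c > 0"
    and super: "\<And>L1 L2. 0 \<le> L1 \<Longrightarrow> 0 \<le> L2 \<Longrightarrow>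
      \<exists>L\<in>{L1 + L2..L1 + L2 + c}. p L1 * p L2 \<le> C * (L1 + L2 + c) * p L"
    and "L \<ge> 0" and B: "B = 9 * C * (L + c)" and "m \<ge> 1"
  shows "\<exists>L'. 0 \<le> L' \<and> L' + c \<le> real m * (L + c) \<and> (p L / B) ^ m * (B * real m) \<le> p L'"
  using \<open>m \<ge> 1\<close>
proof (induction m rule: less_induct)
  case (less m)
  have B0: "B > 0"
    using B assms(2,3,5) by simp
  show ?case
  proof (cases "m = 1")
    case True
    then show ?thesis
      using B0 assms(5) by (intro exI[of _ L]) simp
  next
    case False
    define m1 m2 where "m1 = m div 2" and "m2 = m - m div 2"
    \<comment> \<open>Both halves are at least a third of \<open>m\<close>, whence the factor 9 in \<open>B\<close>.\<close>
    have m: "m1 \<ge> 1" "m2 \<ge> 1" "m1 < m" "m2 < m" "m = m1 + m2" "m \<le> 3 * m1" "m \<le> 3 * m2"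
      using less.prems False by (auto simp: m1_def m2_def)
    obtain L1 where L1: "0 \<le> L1" "L1 + c \<le> real m1 * (L + c)" "(p L / B) ^ m1 * (B * real m1) \<le> p L1"
      using less.IH[OF m(3,1)] by blast
    obtain L2 where L2: "0 \<le> L2" "L2 + c \<le> real m2 * (L + c)" "(p L / B) ^ m2 * (B * real m2) \<le> p L2"
      using less.IH[OF m(4,2)] by blast
    obtain L' where L': "L' \<in> {L1 + L2..L1 + L2 + c}" "p L1 * p L2 \<le> C * (L1 + L2 + c) * p L'"
      using super[OF L1(1) L2(1)] by blast
    have mm: "real m * (L + c) = real m1 * (L + c) + real m2 * (L + c)"
      using m(5) by (simp add: distrib_right)
    have Q: "p L / B \<ge> 0"
      using nonneg B0 by simp
    define D where "D = C * (real m * (L + c))"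
    have D0: "D > 0"
      using assms(2,3,5) less.prems by (simp add: D_def)
    have "m * m \<le> (3 * m1) * (3 * m2)"
      using m(6,7) by (intro mult_le_mono)
    then have "m * m \<le> 9 * (m1 * m2)"
      by simp
    then have "real (m * m) \<le> real (9 * (m1 * m2))"
      by (simp only: of_nat_le_iff)
    then have sq: "real m * real m \<le> 9 * (real m1 * real m2)"
      by simp
    have "(p L / B) ^ m * (B * real m) * D = (p L / B) ^ m * (B * (C * (L + c)) * (real m * real m))"
      by (simp add: D_def algebra_simps)
    also have "\<dots> \<le> (p L / B) ^ m * (B * (C * (L + c)) * (9 * (real m1 * real m2)))"
      using Q B0 assms(2,3,5) sq by (intro mult_left_mono) auto
    also have "\<dots> = ((p L / B) ^ m1 * (B * real m1)) * ((p L / B) ^ m2 * (B * real m2))"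
      using m(5) B by (simp add: power_add)
    also have "\<dots> \<le> p L1 * p L2"
      using L1(3) L2(3) Q B0 nonneg by (intro mult_mono) auto
    also have "\<dots> \<le> C * (L1 + L2 + c) * p L'"
      by (rule L'(2))
    also have "\<dots> \<le> D * p L'"
      unfolding D_def using L1 L2 mm assms(2,3) nonneg
      by (intro mult_right_mono mult_left_mono) auto
    finally have "(p L / B) ^ m * (B * real m) \<le> p L'"
      using D0 by (simp add: mult.commute)
    moreover have "L' + c \<le> real m * (L + c)"
      using L'(1) L1(2) L2(2) mm by auto
    ultimately show ?thesis
      using L'(1) L1(1) L2(1) by (intro exI[of _ L']) auto
  qed
qed

text \<open>If the values of such a function bound another one at all later arguments, then the upper growth
  rate of the former is at most the lower growth rate of the latter.\<close>

lemma Limsup_le_Liminf_supermultiplicative: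
  fixes p N :: "real \<Rightarrow> nat"
  assumes "C > 0" "c > 0"
    and super: "\<And>L1 L2. 0 \<le> L1 \<Longrightarrow> 0 \<le> L2 \<Longrightarrow>
      \<exists>L\<in>{L1 + L2..L1 + L2 + c}. real (p L1) * real (p L2) \<le> C * (L1 + L2 + c) * real (p L)"
    and "C' > 0" "c' > 0" and bound: "\<And>L T. 0 \<le> L \<Longrightarrow> L + c' \<le> T \<Longrightarrow> real (p L) \<le> C' * real (N T)"
  shows "Limsup at_top (\<lambda>L. elog (enat (p L)) / ereal L) \<le>
    Liminf at_top (\<lambda>T. elog (enat (N T)) / ereal T)"
  unfolding le_Liminf_iff
proof (intro allI impI)
  fix y assume "y < Limsup at_top (\<lambda>L. elog (enat (p L)) / ereal L)"
  then obtain r where r: "y < ereal r" "ereal r < Limsup at_top (\<lambda>L. elog (enat (p L)) / ereal L)"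
    using ereal_dense2 by blast
  obtain r' where r': "r < r'" "ereal r' < Limsup at_top (\<lambda>L. elog (enat (p L)) / ereal L)"
    using ereal_dense2[OF r(2)] by auto
  have freq: "frequently (\<lambda>L. elog (enat (p L)) / ereal L > ereal r') at_top"
  proof (rule ccontr)
    assume "\<not> ?thesis"
    then have "eventually (\<lambda>L. elog (enat (p L)) / ereal L \<le> ereal r') at_top"
      by (simp add: frequently_def not_less)
    then have "Limsup at_top (\<lambda>L. elog (enat (p L)) / ereal L) \<le> ereal r'"
      by (rule Limsup_bounded)
    then show False
      using r'(2) by (simp add: not_le[symmetric])
  qed
  have "((\<lambda>L. (r' * L - ln (9 * C * (L + c))) / (L + c)) \<longlongrightarrow> r') at_top"
    using assms(1,2) by real_asymp
  then have "eventually (\<lambda>L. (r' * L - ln (9 * C * (L + c))) / (L + c) > r) at_top"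
    using r'(1) order_tendstoD(1) by blast
  then have "eventually (\<lambda>L. (r' * L - ln (9 * C * (L + c))) / (L + c) > r \<and> L > 0) at_top"
    by (intro eventually_conj eventually_gt_at_top)
  from frequently_ex[OF frequently_eventually_conj[OF freq this]]
  obtain L where L: "elog (enat (p L)) / ereal L > ereal r'"
    "(r' * L - ln (9 * C * (L + c))) / (L + c) > r" "L > 0"
    by blast
  have pL: "p L \<noteq> 0" "ln (real (p L)) > r' * L"
    using L(1,3) by (auto simp: elog_over_ereal field_simps split: if_splits)
  \<comment> \<open>The value at \<open>L\<close> alone guarantees the growth rate \<open>\<rho>\<close>, and \<open>L\<close> is so large that the losses
      contained in \<open>B\<close> leave \<open>\<rho>\<close> above \<open>r\<close>.\<close>
  define B Q \<rho> where "B = 9 * C * (L + c)" and "Q = real (p L) / B" and "\<rho> = ln Q / (L + c)"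
  have B: "B > 0" and Q: "Q > 0" and Lc: "L + c > 0"
    using assms(1,2) L(3) pL(1) by (auto simp: B_def Q_def)
  have "ln Q = ln (real (p L)) - ln B"
    using B pL(1) by (simp add: Q_def ln_div)
  then have "(r' * L - ln B) / (L + c) < \<rho>"
    unfolding \<rho>_def using pL(2) Lc by (intro divide_strict_right_mono) auto
  then have \<rho>: "r < \<rho>"
    using L(2) by (simp add: B_def)
  define D where "D = ln B - ln C' - \<bar>\<rho>\<bar> * (c' + (L + c))"
  have "((\<lambda>T. \<rho> + D / T) \<longlongrightarrow> \<rho>) at_top"
    by real_asymp
  then have "eventually (\<lambda>T. \<rho> + D / T > r) at_top"
    using \<rho> order_tendstoD(1) by blast
  then show "eventually (\<lambda>T. y < elog (enat (N T)) / ereal T) at_top"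
    using eventually_ge_at_top[of "c' + (L + c)"]
  proof eventually_elim
    case (elim T)
    have T: "T > 0"
      using elim(2) Lc assms(5) by linarith
    define m where "m = nat \<lfloor>(T - c') / (L + c)\<rfloor>"
    have q: "(T - c') / (L + c) \<ge> 1"
      using elim(2) Lc by simp
    then have "real m \<le> (T - c') / (L + c)" "(T - c') / (L + c) \<le> real m + 1"
      unfolding m_def by linarith+
    then have m: "real m * (L + c) \<le> T - c'" "T - c' \<le> real m * (L + c) + (L + c)"
      using Lc by (simp_all add: field_simps)
    have m1: "m \<ge> 1"
      using q unfolding m_def by linarith
    obtain L' where L': "0 \<le> L'" "L' + c \<le> real m * (L + c)" "Q ^ m * (B * real m) \<le> real (p L')"
      using supermultiplicative_iterate[of "\<lambda>L. real (p L)" C c L B m] super assms(1,2) L(3) m1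
      unfolding B_def Q_def by auto
    have "real (p L') \<le> C' * real (N T)"
      using bound[OF L'(1), of T] L'(2) m(1) assms(2) by simp
    moreover have "Q ^ m * B \<le> Q ^ m * (B * real m)"
      using Q B m1 by simp
    ultimately have le: "Q ^ m * B \<le> C' * real (N T)"
      using L'(3) by linarith
    have "0 < Q ^ m * B"
      using Q B by simp
    then have NT: "N T \<noteq> 0"
      using le by (cases "N T = 0") auto
    have "ln (Q ^ m * B) \<le> ln (C' * real (N T))"
      using le \<open>0 < Q ^ m * B\<close> by (simp add: ln_mono)
    then have "real m * ln Q + ln B \<le> ln C' + ln (real (N T))"
      using Q B assms(4) NT by (simp add: ln_mult ln_realpow)
    moreover have "real m * ln Q \<ge> \<rho> * T - \<bar>\<rho>\<bar> * (c' + (L + c))"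
    proof -
      have "\<rho> * (T - real m * (L + c)) \<le> \<bar>\<rho>\<bar> * (T - real m * (L + c))"
        using m(1) assms(5) by (intro mult_right_mono) auto
      also have "\<dots> \<le> \<bar>\<rho>\<bar> * (c' + (L + c))"
        using m(2) by (intro mult_left_mono) auto
      finally have "\<rho> * T - \<bar>\<rho>\<bar> * (c' + (L + c)) \<le> \<rho> * (real m * (L + c))"
        by (simp add: right_diff_distrib)
      also have "\<dots> = real m * ln Q"
        using Lc by (simp add: \<rho>_def)
      finally show ?thesis .
    qed
    ultimately have "\<rho> * T + D \<le> ln (real (N T))"
      by (simp add: D_def)
    then have "(\<rho> * T + D) / T \<le> ln (real (N T)) / T"
      using T by (intro divide_right_mono) auto
    then have "\<rho> + D / T \<le> ln (real (N T)) / T"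
      using T by (simp add: add_divide_distrib)
    then have "ereal r < elog (enat (N T)) / ereal T"
      using elim(1) T NT by (simp add: elog_over_ereal)
    then show ?case
      using r(1) by (rule less_trans[rotated])
  qed
qed

section \<open>Comparing the entropies\<close>

context locally_compact_H_flow
begin

text \<open>A scale at which distinct periodic orbits through a compact set are separated if their periods are
  almost equal. Only its existence matters, whence the choice operator.\<close>

definition separation_scale :: real where
  "separation_scale = (SOME \<alpha>. \<alpha> > 0 \<and> (\<forall>K. compact K \<longrightarrow> (\<exists>w0>0. \<forall>w. 0 < w \<and> w \<le> w0 \<longrightarrow>
     (\<forall>L. finite (periodic_orbits_between \<phi> K L (L + w)) \<and>
       (\<exists>I. finite I \<and> I \<subseteq> segments K L w \<and> separated_segments \<alpha> I \<and>
            card I = card (periodic_orbits_between \<phi> K L (L + w)))))))"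

lemma separation_scale_pos: "separation_scale > 0"
  and separation_scale: "compact K \<Longrightarrow> \<exists>w0>0. \<forall>w. 0 < w \<and> w \<le> w0 \<longrightarrow>
     (\<forall>L. \<exists>I. finite I \<and> I \<subseteq> segments K L w \<and> separated_segments separation_scale I \<and>
            card I = card (periodic_orbits_between \<phi> K L (L + w)))"
proof -
  have *: "separation_scale > 0 \<and> (\<forall>K. compact K \<longrightarrow> (\<exists>w0>0. \<forall>w. 0 < w \<and> w \<le> w0 \<longrightarrow>
     (\<forall>L. finite (periodic_orbits_between \<phi> K L (L + w)) \<and>
       (\<exists>I. finite I \<and> I \<subseteq> segments K L w \<and> separated_segments separation_scale I \<and>
            card I = card (periodic_orbits_between \<phi> K L (L + w))))))"
    unfolding separation_scale_def by (rule someI_ex[OF periodic_orbits_separated])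
  then show "separation_scale > 0"
    by (rule conjunct1)
  show "\<exists>w0>0. \<forall>w. 0 < w \<and> w \<le> w0 \<longrightarrow>
     (\<forall>L. \<exists>I. finite I \<and> I \<subseteq> segments K L w \<and> separated_segments separation_scale I \<and>
            card I = card (periodic_orbits_between \<phi> K L (L + w)))" if "compact K"
    using * that by meson
qed

text \<open>The number of periodic orbits through \<open>K\<close> with period in \<open>{L..L + w}\<close>; the set is finite for
  compact \<open>K\<close>. Orbits are counted with their period, as pairs.\<close>

definition orbit_count :: "'a set \<Rightarrow> real \<Rightarrow> real \<Rightarrow> nat" where
  "orbit_count K w L = card (periodic_orbits_between \<phi> K L (L + w))"

lemma gurevic_entropy_eq_Limsup:
  assumes "compact K"
  shows "gurevic_entropy \<phi> K w = Limsup at_top (\<lambda>L. elog (enat (orbit_count K w L)) / ereal L)"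
  unfolding gurevic_entropy_def orbit_count_def
  using finite_periodic_orbits[OF assms] by (simp add: ecard_def)

lemma orbit_count_window:
  assumes "compact K" "w > 0" "c \<ge> 0"
  obtains n :: nat where "n > 0" "\<And>L. \<exists>L'\<in>{L..L + c}. orbit_count K c L \<le> n * orbit_count K w L'"
  using card_periodic_orbits_window[OF assms(2,3) finite_periodic_orbits[OF assms(1)]]
  unfolding orbit_count_def by blast

lemma gurevic_entropy_window_eq:
  assumes "compact K" "w > 0" "c > 0"
  shows "gurevic_entropy \<phi> K w = gurevic_entropy \<phi> K c"
proof -
  have le: "gurevic_entropy \<phi> K c \<le> gurevic_entropy \<phi> K w" if wc: "w > 0" "c > 0" for w c
  proof -
    obtain n where n: "n > 0" "\<And>L. \<exists>L'\<in>{L..L + c}. orbit_count K c L \<le> n * orbit_count K w L'"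
      using orbit_count_window[OF assms(1) wc(1), of c] wc(2) by auto
    have "\<exists>T\<in>{L..L + c}. real (orbit_count K c L) \<le> (real n / c) * (L + c) * real (orbit_count K w T)"
      if "L > 0" for L
    proof -
      obtain T where T: "T \<in> {L..L + c}" "orbit_count K c L \<le> n * orbit_count K w T"
        using n(2) by blast
      have "real (orbit_count K c L) \<le> real n * real (orbit_count K w T)"
        using T(2) unfolding of_nat_mult[symmetric] of_nat_le_iff .
      also have "\<dots> \<le> (real n / c) * (L + c) * real (orbit_count K w T)"
        using that wc(2) n(1) by (intro mult_right_mono) (auto simp: field_simps)
      finally show ?thesis
        using T(1) by blast
    qed
    then show ?thesis
      unfolding gurevic_entropy_eq_Limsup[OF assms(1)]
      using n(1) wc(2) by (intro Limsup_elog_le[of "real n / c" c]) auto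
  qed
  show ?thesis
    using le[OF assms(2,3)] le[OF assms(3,2)] by (rule antisym[rotated])
qed

lemma exists_periodic_orbit:
  assumes "compact K" "interior K \<noteq> {}"
  shows "\<exists>\<gamma> T. (\<gamma>, T) \<in> periodic_orbits \<phi> \<and> T \<ge> 1 \<and> \<gamma> \<inter> K \<noteq> {}"
proof -
  obtain z0 where z0: "z0 \<in> interior K"
    using assms(2) by blast
  let ?K0 = "{z0, \<phi> 1 z0}"
  obtain C c :: real where "C > 0" "c > 0" and glue:
    "\<And>L1 L2 I1 I2. 0 \<le> L1 \<Longrightarrow> 0 \<le> L2 \<Longrightarrow> finite I1 \<Longrightarrow> finite I2 \<Longrightarrow>
      I1 \<subseteq> segments ?K0 L1 0 \<Longrightarrow> I2 \<subseteq> segments ?K0 L2 0 \<Longrightarrow>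
      separated_segments 1 I1 \<Longrightarrow> separated_segments 1 I2 \<Longrightarrow>
      real (card I1) * real (card I2) \<le>
        C * (L1 + L2 + c) * real (card (periodic_orbits_between \<phi> K (L1 + L2) (L1 + L2 + c)))"
    by (rule glue_two_families[of ?K0 K z0 1 0]) (use assms(1) z0 in auto)
  have "real (card {(z0, 1::real)}) * real (card {(z0, 0::real)}) \<le>
      C * (1 + 0 + c) * real (card (periodic_orbits_between \<phi> K (1 + 0) (1 + 0 + c)))"
    by (rule glue) (auto simp: segments_def separated_segments_def)
  then have "card (periodic_orbits_between \<phi> K 1 (1 + c)) \<noteq> 0"
    by (intro notI) simp
  then have "periodic_orbits_between \<phi> K 1 (1 + c) \<noteq> {}"
    by auto
  then show ?thesis
    unfolding periodic_orbits_between_def by auto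
qed

text \<open>The minimal period is an infimum; a period below twice its value is all that is needed, so its
  being attained need not be shown.\<close>

lemma min_period_bounds:
  assumes "compact K" "interior K \<noteq> {}"
  shows "1 \<le> min_period \<phi> K"
    and "\<exists>p0 \<tau>0. \<phi> \<tau>0 p0 = p0 \<and> 0 < \<tau>0 \<and> \<tau>0 < 2 * min_period \<phi> K"
proof -
  define S where "S = {T. T \<ge> 1 \<and> (\<exists>\<gamma>. (\<gamma>, T) \<in> periodic_orbits \<phi> \<and> \<gamma> \<inter> K \<noteq> {})}"
  have S: "S \<noteq> {}"
    using exists_periodic_orbit[OF assms] by (auto simp: S_def)
  have mp: "min_period \<phi> K = Inf S"
    by (simp add: min_period_def S_def)
  show mp1: "1 \<le> min_period \<phi> K"
    unfolding mp by (rule cInf_greatest[OF S]) (simp add: S_def)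
  obtain \<tau>0 where \<tau>0: "\<tau>0 \<in> S" "\<tau>0 < 2 * min_period \<phi> K"
    using cInf_lessD[OF S, of "2 * min_period \<phi> K"] mp mp1 by auto
  then obtain \<gamma> p0 where "(\<gamma>, \<tau>0) \<in> periodic_orbits \<phi>" "p0 \<in> \<gamma>"
    unfolding S_def by blast
  from periodic_orbitsD(1,2)[OF this] \<tau>0(2)
  show "\<exists>p0 \<tau>0. \<phi> \<tau>0 p0 = p0 \<and> 0 < \<tau>0 \<and> \<tau>0 < 2 * min_period \<phi> K"
    by (intro exI[of _ p0] exI[of _ \<tau>0]) simp
qed

lemma chord_number_nat:
  assumes "compact K'" "ball x \<eta> \<subseteq> K'" "\<delta> > 0"
  obtains N where "\<And>T. chord_number \<phi> x y \<eta> T (T + \<tau>) \<delta> = enat (N T)"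
    "\<And>T W. W \<subseteq> chords \<phi> x y \<eta> T (T + \<tau>) \<Longrightarrow> separating \<phi> \<delta> T W \<Longrightarrow> card W \<le> N T"
    "\<And>T. \<exists>E. finite E \<and> E \<subseteq> chords \<phi> x y \<eta> T (T + \<tau>) \<and> separating \<phi> \<delta> T E \<and> card E = N T"
proof -
  have "\<forall>T. \<exists>n. chord_number \<phi> x y \<eta> T (T + \<tau>) \<delta> = enat n \<and>
    (\<forall>W. W \<subseteq> chords \<phi> x y \<eta> T (T + \<tau>) \<and> separating \<phi> \<delta> T W \<longrightarrow> card W \<le> n) \<and>
    (\<exists>E. finite E \<and> E \<subseteq> chords \<phi> x y \<eta> T (T + \<tau>) \<and> separating \<phi> \<delta> T E \<and> card E = n)"
    using chord_number_attained[OF assms] by blast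
  from choice[OF this] obtain N where "\<forall>T. chord_number \<phi> x y \<eta> T (T + \<tau>) \<delta> = enat (N T) \<and>
    (\<forall>W. W \<subseteq> chords \<phi> x y \<eta> T (T + \<tau>) \<and> separating \<phi> \<delta> T W \<longrightarrow> card W \<le> N T) \<and>
    (\<exists>E. finite E \<and> E \<subseteq> chords \<phi> x y \<eta> T (T + \<tau>) \<and> separating \<phi> \<delta> T E \<and> card E = N T)"
    by (elim exE)
  then show thesis
    by (intro that[of N]) blast+
qed

text \<open>Closing up chords shows that there are not more chords than periodic orbits.\<close>

lemma chord_Limsup_le_gurevic:
  assumes K: "compact K" "interior K \<noteq> {}"
    and K': "compact K'" "ball x \<eta> \<subseteq> K'" "ball y \<eta> \<subseteq> K'"
    and "\<delta> > 0" "\<tau> > 0" "\<sigma> > 0"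
  shows "Limsup at_top (\<lambda>T. elog (chord_number \<phi> x y \<eta> T (T + \<tau>) \<delta>) / ereal T) \<le>
    gurevic_entropy \<phi> K \<sigma>"
proof -
  obtain z0 where z0: "z0 \<in> interior K"
    using K(2) by blast
  obtain N where N: "\<And>T. chord_number \<phi> x y \<eta> T (T + \<tau>) \<delta> = enat (N T)"
    "\<And>T W. W \<subseteq> chords \<phi> x y \<eta> T (T + \<tau>) \<Longrightarrow> separating \<phi> \<delta> T W \<Longrightarrow> card W \<le> N T"
    "\<And>T. \<exists>E. finite E \<and> E \<subseteq> chords \<phi> x y \<eta> T (T + \<tau>) \<and> separating \<phi> \<delta> T E \<and> card E = N T"
    using that by (rule chord_number_nat[OF K'(1,2) assms(6)])
  let ?K0 = "insert z0 K'"
  have K0: "compact ?K0"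
    using K'(1) by simp
  obtain C c :: real where C: "C > 0" "c > 0" and glue:
    "\<And>L1 L2 I1 I2. 0 \<le> L1 \<Longrightarrow> 0 \<le> L2 \<Longrightarrow> finite I1 \<Longrightarrow> finite I2 \<Longrightarrow>
      I1 \<subseteq> segments ?K0 L1 \<tau> \<Longrightarrow> I2 \<subseteq> segments ?K0 L2 \<tau> \<Longrightarrow>
      separated_segments \<delta> I1 \<Longrightarrow> separated_segments \<delta> I2 \<Longrightarrow>
      real (card I1) * real (card I2) \<le>
        C * (L1 + L2 + c) * real (card (periodic_orbits_between \<phi> K (L1 + L2) (L1 + L2 + c)))"
    using that by (rule glue_two_families[OF K0 K(1) z0 assms(6) less_imp_le[OF assms(7)]])
  have "\<exists>T\<in>{L..L + c}. real (N L) \<le> C * (L + c) * real (orbit_count K c T)" if L: "L > 0" for L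
  proof -
    obtain E where E: "finite E" "E \<subseteq> chords \<phi> x y \<eta> L (L + \<tau>)" "separating \<phi> \<delta> L E" "card E = N L"
      using N(3)[of L] by blast
    have "\<forall>z\<in>E. \<exists>t. t \<in> {L..L + \<tau>} \<and> \<phi> t z \<in> ball y \<eta>"
      using E(2) unfolding chords_def by blast
    from bchoice[OF this] obtain t where t: "\<forall>z\<in>E. t z \<in> {L..L + \<tau>} \<and> \<phi> (t z) z \<in> ball y \<eta>"
      by (elim exE)
    define I where "I = (\<lambda>z. (z, t z)) ` E"
    have "inj_on (\<lambda>z. (z, t z)) E"
      by (auto simp: inj_on_def)
    then have cI: "card I = N L"
      unfolding I_def using card_image E(4) by metis
    have "E \<subseteq> K'"
      using E(2) K'(2) unfolding chords_def by blast
    moreover have "\<phi> (t z) z \<in> K'" if "z \<in> E" for z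
      using t K'(3) that by blast
    ultimately have "I \<subseteq> segments ?K0 L \<tau>"
      using t by (auto simp: I_def segments_def)
    moreover have "separated_segments \<delta> I"
    proof (rule separated_segmentsI)
      fix p s q s' assume i: "(p, s) \<in> I" "(q, s') \<in> I" "(p, s) \<noteq> (q, s')"
      then have pq: "p \<in> E" "q \<in> E" "p \<noteq> q" "L \<le> s" "L \<le> s'"
        using t by (auto simp: I_def)
      then obtain u where "u \<in> {0..L}" "\<delta> \<le> dist (\<phi> u p) (\<phi> u q)"
        using E(3) unfolding separating_def by blast
      then show "\<exists>u\<in>{0..min s s'}. \<delta> \<le> dist (\<phi> u p) (\<phi> u q)"
        using pq(4,5) by (intro bexI[of _ u]) auto
    qed
    moreover have "{(z0, 0)} \<subseteq> segments ?K0 0 \<tau>" "separated_segments \<delta> {(z0, 0)}"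
      using assms(7) by (auto simp: segments_def separated_segments_def)
    moreover have "finite I"
      using E(1) by (simp add: I_def)
    ultimately have "real (card I) * real (card {(z0, 0::real)}) \<le>
        C * (L + 0 + c) * real (card (periodic_orbits_between \<phi> K (L + 0) (L + 0 + c)))"
      using L by (intro glue) auto
    then have "real (N L) \<le> C * (L + c) * real (orbit_count K c L)"
      by (simp add: cI orbit_count_def)
    then show ?thesis
      using C(2) by (intro bexI[of _ L]) auto
  qed
  then have "Limsup at_top (\<lambda>T. elog (enat (N T)) / ereal T) \<le> gurevic_entropy \<phi> K c"
    unfolding gurevic_entropy_eq_Limsup[OF K(1)] using C by (intro Limsup_elog_le[of C c]) auto
  also have "\<dots> = gurevic_entropy \<phi> K \<sigma>"
    by (rule gurevic_entropy_window_eq[OF K(1) C(2) assms(8)])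
  finally show ?thesis
    by (simp add: N(1))
qed

text \<open>Conversely, opening periodic orbits gives enough chords. The length of the window for the hitting
  time is arbitrary here, because upper limits tolerate a bounded shift of \<open>T\<close>.\<close>

lemma gurevic_le_chord_Limsup:
  assumes K: "compact K" "interior K \<noteq> {}" and K': "compact K'" "ball x \<eta> \<subseteq> K'"
    and "0 < \<delta>" "\<delta> < separation_scale" "\<eta> > 0" "\<tau> > 0" "\<sigma> > 0"
  shows "gurevic_entropy \<phi> K \<sigma> \<le>
    Limsup at_top (\<lambda>T. elog (chord_number \<phi> x y \<eta> T (T + \<tau>) \<delta>) / ereal T)"
proof -
  obtain N where N: "\<And>T. chord_number \<phi> x y \<eta> T (T + \<tau>) \<delta> = enat (N T)"
    "\<And>T W. W \<subseteq> chords \<phi> x y \<eta> T (T + \<tau>) \<Longrightarrow> separating \<phi> \<delta> T W \<Longrightarrow> card W \<le> N T"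
    "\<And>T. \<exists>E. finite E \<and> E \<subseteq> chords \<phi> x y \<eta> T (T + \<tau>) \<and> separating \<phi> \<delta> T E \<and> card E = N T"
    using that by (rule chord_number_nat[OF K' assms(5)])
  obtain w0 where w0: "w0 > 0" "\<And>w L. 0 < w \<Longrightarrow> w \<le> w0 \<Longrightarrow>
     \<exists>I. finite I \<and> I \<subseteq> segments K L w \<and> separated_segments separation_scale I \<and>
            card I = card (periodic_orbits_between \<phi> K L (L + w))"
    using separation_scale[OF K(1)] by blast
  define w where "w = min w0 \<tau>"
  have w: "0 < w" "w \<le> w0" "w \<le> \<tau>"
    using w0(1) assms(8) by (auto simp: w_def)
  obtain p0 \<tau>0 where p0: "\<phi> \<tau>0 p0 = p0" "\<tau>0 > 0"
    using exists_periodic_orbit[OF K] periodic_orbitsD by blast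
  obtain C :: nat and c :: real where C: "C > 0" "c > 0" and chords:
    "\<And>L I. 0 \<le> L \<Longrightarrow> finite I \<Longrightarrow> I \<subseteq> segments K L w \<Longrightarrow> separated_segments separation_scale I \<Longrightarrow>
      \<exists>S\<in>{0..c}. \<forall>(j::nat) T \<tau>. L + S \<le> T \<and> T \<le> L + S + real j * \<tau>0 \<and>
          L + S + real j * \<tau>0 + w \<le> T + \<tau> \<longrightarrow>
        (\<exists>W. W \<subseteq> chords \<phi> x y \<eta> T (T + \<tau>) \<and> separating \<phi> \<delta> T W \<and> card I \<le> C * card W)"
    using that by (rule segments_to_chords[OF K(1) p0 assms(7,6,5) less_imp_le[OF w(1)]])
  have "\<exists>T\<in>{L..L + c}. real (orbit_count K w L) \<le> (real C / c) * (L + c) * real (N T)"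
    if L: "L > 0" for L
  proof -
    obtain I where I: "finite I" "I \<subseteq> segments K L w" "separated_segments separation_scale I"
      "card I = orbit_count K w L"
      using w0(2)[OF w(1,2)] unfolding orbit_count_def by blast
    obtain S where S: "S \<in> {0..c}" and "\<forall>(j::nat) T \<tau>. L + S \<le> T \<and> T \<le> L + S + real j * \<tau>0 \<and>
          L + S + real j * \<tau>0 + w \<le> T + \<tau> \<longrightarrow>
        (\<exists>W. W \<subseteq> chords \<phi> x y \<eta> T (T + \<tau>) \<and> separating \<phi> \<delta> T W \<and> card I \<le> C * card W)"
      using chords[OF less_imp_le[OF L] I(1-3)] by (elim bexE)
    from this(2)[rule_format, of "L + S" 0 \<tau>] w(3) obtain W
      where W: "W \<subseteq> chords \<phi> x y \<eta> (L + S) (L + S + \<tau>)" "separating \<phi> \<delta> (L + S) W"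
        "card I \<le> C * card W"
      by auto
    have "card I \<le> C * N (L + S)"
      using N(2)[OF W(1,2)] W(3) by (meson mult_le_mono2 order_trans)
    then have "real (orbit_count K w L) \<le> real C * real (N (L + S))"
      unfolding of_nat_mult[symmetric] of_nat_le_iff I(4) .
    also have "\<dots> \<le> (real C / c) * (L + c) * real (N (L + S))"
      using L C by (intro mult_right_mono) (auto simp: field_simps)
    finally show ?thesis
      using S by (intro bexI[of _ "L + S"]) auto
  qed
  then have "gurevic_entropy \<phi> K w \<le> Limsup at_top (\<lambda>T. elog (enat (N T)) / ereal T)"
    unfolding gurevic_entropy_eq_Limsup[OF K(1)] using C
    by (intro Limsup_elog_le[of "real C / c" c]) auto
  then show ?thesis
    unfolding N(1) gurevic_entropy_window_eq[OF K(1) assms(9) w(1)] .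
qed

text \<open>Gluing pairs of periodic orbits. The window that contains the periods of the glued orbits is
  longer than \<open>w\<close>; by the pigeonhole principle one of its parts of length \<open>w\<close> contains a fixed
  proportion of them.\<close>

lemma orbit_count_supermultiplicative:
  assumes "compact K" "interior K \<noteq> {}" "w > 0"
    and sep: "\<And>L. \<exists>I. finite I \<and> I \<subseteq> segments K L w \<and> separated_segments separation_scale I \<and>
            card I = card (periodic_orbits_between \<phi> K L (L + w))"
  obtains C c where "C > 0" "c > 0" "\<And>L1 L2. 0 \<le> L1 \<Longrightarrow> 0 \<le> L2 \<Longrightarrow>
    \<exists>L\<in>{L1 + L2..L1 + L2 + c}. real (orbit_count K w L1) * real (orbit_count K w L2) \<le>
      C * (L1 + L2 + c) * real (orbit_count K w L)"
proof -
  obtain z0 where z0: "z0 \<in> interior K"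
    using assms(2) by blast
  obtain C c :: real where C: "C > 0" "c > 0" and glue:
    "\<And>L1 L2 I1 I2. 0 \<le> L1 \<Longrightarrow> 0 \<le> L2 \<Longrightarrow> finite I1 \<Longrightarrow> finite I2 \<Longrightarrow>
      I1 \<subseteq> segments K L1 w \<Longrightarrow> I2 \<subseteq> segments K L2 w \<Longrightarrow>
      separated_segments separation_scale I1 \<Longrightarrow> separated_segments separation_scale I2 \<Longrightarrow>
      real (card I1) * real (card I2) \<le>
        C * (L1 + L2 + c) * real (card (periodic_orbits_between \<phi> K (L1 + L2) (L1 + L2 + c)))"
    using that by (rule glue_two_families[OF assms(1,1) z0 separation_scale_pos less_imp_le[OF assms(3)]])
  obtain n where n: "n > 0" "\<And>L. \<exists>L'\<in>{L..L + c}. orbit_count K c L \<le> n * orbit_count K w L'"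
    using orbit_count_window[OF assms(1,3), of c] C(2) by auto
  have main: "\<exists>L\<in>{L1 + L2..L1 + L2 + c}. real (orbit_count K w L1) * real (orbit_count K w L2) \<le>
      (C * real n) * (L1 + L2 + c) * real (orbit_count K w L)" if L: "0 \<le> L1" "0 \<le> L2" for L1 L2
  proof -
    obtain I1 where I1: "finite I1" "I1 \<subseteq> segments K L1 w" "separated_segments separation_scale I1"
      "card I1 = orbit_count K w L1"
      using sep[of L1] unfolding orbit_count_def by blast
    obtain I2 where I2: "finite I2" "I2 \<subseteq> segments K L2 w" "separated_segments separation_scale I2"
      "card I2 = orbit_count K w L2"
      using sep[of L2] unfolding orbit_count_def by blast
    obtain L where L': "L \<in> {L1 + L2..L1 + L2 + c}"
      "orbit_count K c (L1 + L2) \<le> n * orbit_count K w L"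
      using n(2) by blast
    have "real (orbit_count K w L1) * real (orbit_count K w L2) \<le>
        C * (L1 + L2 + c) * real (orbit_count K c (L1 + L2))"
      using glue[OF L I1(1) I2(1) I1(2) I2(2) I1(3) I2(3)] I1(4) I2(4)
      by (simp add: orbit_count_def)
    also have "\<dots> \<le> C * (L1 + L2 + c) * real (n * orbit_count K w L)"
      using L C L'(2) by (intro mult_left_mono) (simp_all only: of_nat_le_iff, simp)
    finally show ?thesis
      using L'(1) by (intro bexI[of _ L]) (simp_all add: mult_ac)
  qed
  show thesis
    by (rule that[OF _ C(2) main]) (use C n in auto)
qed

text \<open>For lower limits the hitting window must contain a whole turn of an auxiliary periodic orbit
  through \<open>K\<close>: inserting \<open>j\<close> turns makes the orbits with period near \<open>L\<close> into chords for every
  sufficiently large \<open>T\<close>, not only for \<open>T\<close> near \<open>L\<close>.\<close>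

lemma gurevic_le_chord_Liminf:
  assumes K: "compact K" "interior K \<noteq> {}" and K': "compact K'" "ball x \<eta> \<subseteq> K'"
    and "0 < \<delta>" "\<delta> < separation_scale" "\<eta> > 0" "\<tau> \<ge> 5 * min_period \<phi> K" "\<sigma> > 0"
  shows "gurevic_entropy \<phi> K \<sigma> \<le>
    Liminf at_top (\<lambda>T. elog (chord_number \<phi> x y \<eta> T (T + \<tau>) \<delta>) / ereal T)"
proof -
  obtain N where N: "\<And>T. chord_number \<phi> x y \<eta> T (T + \<tau>) \<delta> = enat (N T)"
    "\<And>T W. W \<subseteq> chords \<phi> x y \<eta> T (T + \<tau>) \<Longrightarrow> separating \<phi> \<delta> T W \<Longrightarrow> card W \<le> N T"
    "\<And>T. \<exists>E. finite E \<and> E \<subseteq> chords \<phi> x y \<eta> T (T + \<tau>) \<and> separating \<phi> \<delta> T E \<and> card E = N T"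
    using that by (rule chord_number_nat[OF K' assms(5)])
  obtain w0 where w0: "w0 > 0" "\<And>w L. 0 < w \<Longrightarrow> w \<le> w0 \<Longrightarrow>
     \<exists>I. finite I \<and> I \<subseteq> segments K L w \<and> separated_segments separation_scale I \<and>
            card I = card (periodic_orbits_between \<phi> K L (L + w))"
    using separation_scale[OF K(1)] by blast
  define w where "w = min w0 1"
  have w: "0 < w" "w \<le> w0" "w \<le> 1"
    using w0(1) by (auto simp: w_def)
  have mp1: "1 \<le> min_period \<phi> K"
    by (rule min_period_bounds(1)[OF K])
  obtain p0 \<tau>0 where p0: "\<phi> \<tau>0 p0 = p0" "\<tau>0 > 0" and \<tau>0: "\<tau>0 < 2 * min_period \<phi> K"
    using min_period_bounds(2)[OF K] by blast
  have \<tau>: "\<tau>0 + w \<le> \<tau>"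
    using \<tau>0 w(3) mp1 assms(8) by linarith
  obtain C :: nat and c :: real where C: "C > 0" "c > 0" and chords:
    "\<And>L I. 0 \<le> L \<Longrightarrow> finite I \<Longrightarrow> I \<subseteq> segments K L w \<Longrightarrow> separated_segments separation_scale I \<Longrightarrow>
      \<exists>S\<in>{0..c}. \<forall>(j::nat) T \<tau>. L + S \<le> T \<and> T \<le> L + S + real j * \<tau>0 \<and>
          L + S + real j * \<tau>0 + w \<le> T + \<tau> \<longrightarrow>
        (\<exists>W. W \<subseteq> chords \<phi> x y \<eta> T (T + \<tau>) \<and> separating \<phi> \<delta> T W \<and> card I \<le> C * card W)"
    using that by (rule segments_to_chords[OF K(1) p0 assms(7,6,5) less_imp_le[OF w(1)]])
  have bound: "real (orbit_count K w L) \<le> real C * real (N T)" if L: "0 \<le> L" "L + c \<le> T" for L T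
  proof -
    obtain I where I: "finite I" "I \<subseteq> segments K L w" "separated_segments separation_scale I"
      "card I = orbit_count K w L"
      using w0(2)[OF w(1,2)] unfolding orbit_count_def by blast
    obtain S where S: "S \<in> {0..c}" and SW: "\<forall>(j::nat) T \<tau>. L + S \<le> T \<and> T \<le> L + S + real j * \<tau>0 \<and>
          L + S + real j * \<tau>0 + w \<le> T + \<tau> \<longrightarrow>
        (\<exists>W. W \<subseteq> chords \<phi> x y \<eta> T (T + \<tau>) \<and> separating \<phi> \<delta> T W \<and> card I \<le> C * card W)"
      using chords[OF L(1) I(1-3)] by (elim bexE)
    define j where "j = nat \<lceil>(T - (L + S)) / \<tau>0\<rceil>"
    have "0 \<le> (T - (L + S)) / \<tau>0"
      using L(2) S p0(2) by auto
    then have "(T - (L + S)) / \<tau>0 \<le> real j" "real j \<le> (T - (L + S)) / \<tau>0 + 1"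
      unfolding j_def by linarith+
    then have j: "T - (L + S) \<le> real j * \<tau>0" "real j * \<tau>0 \<le> T - (L + S) + \<tau>0"
      using p0(2) by (simp_all add: field_simps)
    have "L + S \<le> T \<and> T \<le> L + S + real j * \<tau>0 \<and> L + S + real j * \<tau>0 + w \<le> T + \<tau>"
      using j \<tau> L(2) S by auto
    from SW[rule_format, OF this] obtain W
      where W: "W \<subseteq> chords \<phi> x y \<eta> T (T + \<tau>)" "separating \<phi> \<delta> T W" "card I \<le> C * card W"
      by blast
    have "card I \<le> C * N T"
      using N(2)[OF W(1,2)] W(3) by (meson mult_le_mono2 order_trans)
    then show ?thesis
      unfolding of_nat_mult[symmetric] of_nat_le_iff I(4) .
  qed
  obtain C1 c1 where C1: "C1 > 0" "c1 > 0" and super: "\<And>L1 L2. 0 \<le> L1 \<Longrightarrow> 0 \<le> L2 \<Longrightarrow>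
    \<exists>L\<in>{L1 + L2..L1 + L2 + c1}. real (orbit_count K w L1) * real (orbit_count K w L2) \<le>
      C1 * (L1 + L2 + c1) * real (orbit_count K w L)"
    using that by (rule orbit_count_supermultiplicative[OF K w(1) w0(2)[OF w(1,2)]])
  have "gurevic_entropy \<phi> K w \<le> Liminf at_top (\<lambda>T. elog (enat (N T)) / ereal T)"
    unfolding gurevic_entropy_eq_Limsup[OF K(1)]
    by (rule Limsup_le_Liminf_supermultiplicative[OF C1 super _ C(2) bound]) (use C in auto)
  then show ?thesis
    unfolding N(1) gurevic_entropy_window_eq[OF K(1) assms(9) w(1)] .
qed

lemma chord_Limsup_eq_gurevic:
  assumes "compact K" "interior K \<noteq> {}"
    and "compact K'" "ball x \<eta> \<subseteq> K'" "ball y \<eta> \<subseteq> K'"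
    and "0 < \<delta>" "\<delta> < separation_scale" "\<eta> > 0" "\<tau> > 0" "\<sigma> > 0"
  shows "Limsup at_top (\<lambda>T. elog (chord_number \<phi> x y \<eta> T (T + \<tau>) \<delta>) / ereal T) =
    gurevic_entropy \<phi> K \<sigma>"
  using chord_Limsup_le_gurevic[of K K' x \<eta> y \<delta> \<tau> \<sigma>] gurevic_le_chord_Limsup[of K K' x \<eta> \<delta> \<tau> \<sigma> y]
    assms by (intro antisym) auto

lemma compact_ball_radius:
  fixes K :: "'a set"
  assumes "compact K"
  obtains r K' where "r > 0" "compact K'" "\<And>q \<eta>. q \<in> K \<Longrightarrow> \<eta> \<le> r \<Longrightarrow> ball q \<eta> \<subseteq> K'"
proof -
  obtain r K' where "r > 0" "compact K'" "\<forall>q\<in>K. ball q r \<subseteq> K'"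
    using compact_neighbourhood[OF assms locally_compact] by blast
  then show thesis
    by (intro that[of r K']) (use subset_ball in blast)+
qed

lemma gurevic_entropy_eq:
  assumes "compact K1" "interior K1 \<noteq> {}" "\<sigma>1 > 0" "compact K2" "interior K2 \<noteq> {}" "\<sigma>2 > 0"
  shows "gurevic_entropy \<phi> K1 \<sigma>1 = gurevic_entropy \<phi> K2 \<sigma>2"
proof -
  fix x :: 'a
  obtain r K' where r: "r > 0" "compact K'" "\<And>q \<eta>. q \<in> {x} \<Longrightarrow> \<eta> \<le> r \<Longrightarrow> ball q \<eta> \<subseteq> K'"
    using that by (rule compact_ball_radius[OF compact_insert[OF compact_empty]])
  have "Limsup at_top (\<lambda>T. elog (chord_number \<phi> x x r T (T + 1) (separation_scale / 2)) / ereal T) =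
      gurevic_entropy \<phi> K \<sigma>" if "compact K" "interior K \<noteq> {}" "\<sigma> > 0" for K \<sigma>
    using that r separation_scale_pos by (intro chord_Limsup_eq_gurevic[of K K']) auto
  from this[OF assms(1-3)] this[OF assms(4-6)] show ?thesis
    by simp
qed

lemma chord_entropy_eq_gurevic:
  assumes "compact K" "interior K \<noteq> {}" "\<sigma> > 0" "\<tau> > 0"
  shows "chord_entropy \<phi> x y \<tau> = gurevic_entropy \<phi> K \<sigma>"
proof -
  let ?h = "gurevic_entropy \<phi> K \<sigma>"
  let ?L = "\<lambda>\<delta> \<eta>. Limsup at_top (\<lambda>T. elog (chord_number \<phi> x y \<eta> T (T + \<tau>) \<delta>) / ereal T)"
  obtain r K' where r: "r > 0" "compact K'" "\<And>q \<eta>. q \<in> {x, y} \<Longrightarrow> \<eta> \<le> r \<Longrightarrow> ball q \<eta> \<subseteq> K'"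
    using that by (rule compact_ball_radius[OF compact_insert[OF compact_insert[OF compact_empty]]])
  have inner: "Lim (at_right 0) (?L \<delta>) = ?h" if \<delta>: "0 < \<delta>" "\<delta> < separation_scale" for \<delta>
  proof (rule tendsto_Lim)
    have "eventually (\<lambda>\<eta>. \<eta> \<in> {0<..<r}) (at_right (0::real))"
      using r(1) by (rule eventually_at_right_real)
    moreover have "?L \<delta> \<eta> = ?h" if "\<eta> \<in> {0<..<r}" for \<eta>
      by (rule chord_Limsup_eq_gurevic[OF assms(1,2) r(2)]) (use r(3) \<delta> assms that in simp_all)
    ultimately show "(?L \<delta> \<longlongrightarrow> ?h) (at_right 0)"
      by (intro tendsto_eventually) (rule eventually_mono)
  qed simp
  have "Lim (at_right 0) (\<lambda>\<delta>. Lim (at_right 0) (?L \<delta>)) = ?h"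
  proof (rule tendsto_Lim)
    have "eventually (\<lambda>\<delta>. \<delta> \<in> {0<..<separation_scale}) (at_right (0::real))"
      using separation_scale_pos by (rule eventually_at_right_real)
    then show "((\<lambda>\<delta>. Lim (at_right 0) (?L \<delta>)) \<longlongrightarrow> ?h) (at_right 0)"
      by (intro tendsto_eventually, eventually_elim) (use inner in auto)
  qed simp
  then show ?thesis
    unfolding chord_entropy_def .
qed

lemma chord_number_tendsto_gurevic:
  assumes "compact K" "interior K \<noteq> {}" and K': "compact K'" "ball x \<eta> \<subseteq> K'" "ball y \<eta> \<subseteq> K'"
    and "0 < \<delta>" "\<delta> < separation_scale" "\<eta> > 0" "\<tau> \<ge> 5 * min_period \<phi> K" "\<tau> > 0" "\<sigma> > 0"
  shows "((\<lambda>T. elog (chord_number \<phi> x y \<eta> T (T + \<tau>) \<delta>) / ereal T) \<longlongrightarrow> gurevic_entropy \<phi> K \<sigma>) at_top"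
proof -
  let ?f = "\<lambda>T. elog (chord_number \<phi> x y \<eta> T (T + \<tau>) \<delta>) / ereal T"
  have "gurevic_entropy \<phi> K \<sigma> \<le> Liminf at_top ?f"
    using gurevic_le_chord_Liminf[OF assms(1-4,6-9,11)] .
  moreover have "Limsup at_top ?f \<le> gurevic_entropy \<phi> K \<sigma>"
    using chord_Limsup_le_gurevic[OF assms(1-6,10,11)] .
  moreover have "Liminf at_top ?f \<le> Limsup at_top ?f"
    by (rule Liminf_le_Limsup) simp
  ultimately have "Liminf at_top ?f = gurevic_entropy \<phi> K \<sigma>" "Limsup at_top ?f = gurevic_entropy \<phi> K \<sigma>"
    by auto
  then show ?thesis
    by (intro Liminf_eq_Limsup) auto
qed

end

theorem theorem5p12:
  fixes \<A> :: "('a::complete_space, 'e::euclidean_space) chart set"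
    and g :: "('a, 'e) metric_tensor"
    and \<phi> :: "real \<Rightarrow> 'a \<Rightarrow> 'a"
  assumes "connected_riemannian_manifold \<A> g"
    and "H_flow \<A> \<phi>"
  shows "\<exists>h::ereal.
    (\<forall>K \<sigma>. compact K \<and> interior K \<noteq> {} \<and> \<sigma> > 0 \<longrightarrow> gurevic_entropy \<phi> K \<sigma> = h) \<and>
    (\<forall>x y \<sigma>. \<sigma> > 0 \<longrightarrow> chord_entropy \<phi> x y \<sigma> = h) \<and>
    (\<forall>K. compact K \<and> interior K \<noteq> {} \<longrightarrow>
      (\<exists>\<alpha>0>0. \<forall>x\<in>K. \<forall>y\<in>K. \<forall>\<tau> \<delta> \<eta>.
         \<tau> \<ge> 5 * min_period \<phi> K \<and> 0 < \<delta> \<and> \<delta> < \<alpha>0 / 2 \<and> 0 < \<eta> \<and> \<eta> < \<alpha>0 / 2 \<longrightarrow>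
         ((\<lambda>T. elog (chord_number \<phi> x y \<eta> T (T + \<tau>) \<delta>) / ereal T) \<longlongrightarrow> h) at_top))"
proof -
  interpret locally_compact_H_flow \<phi>
    using H_flow_imp_locally_compact_H_flow[OF assms] .
  obtain K1 :: "'a set" where K1: "compact K1" "interior K1 \<noteq> {}"
    using locally_compact by blast
  let ?h = "gurevic_entropy \<phi> K1 1"
  have h: "gurevic_entropy \<phi> K \<sigma> = ?h" if "compact K" "interior K \<noteq> {}" "\<sigma> > 0" for K \<sigma>
    using gurevic_entropy_eq[OF that K1] by simp
  have "\<exists>\<alpha>0>0. \<forall>x\<in>K. \<forall>y\<in>K. \<forall>\<tau> \<delta> \<eta>.
         \<tau> \<ge> 5 * min_period \<phi> K \<and> 0 < \<delta> \<and> \<delta> < \<alpha>0 / 2 \<and> 0 < \<eta> \<and> \<eta> < \<alpha>0 / 2 \<longrightarrow>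
         ((\<lambda>T. elog (chord_number \<phi> x y \<eta> T (T + \<tau>) \<delta>) / ereal T) \<longlongrightarrow> ?h) at_top"
    if K: "compact K" "interior K \<noteq> {}" for K
  proof -
    obtain r K' where r: "r > 0" "compact K'" "\<And>q \<eta>. q \<in> K \<Longrightarrow> \<eta> \<le> r \<Longrightarrow> ball q \<eta> \<subseteq> K'"
      using that by (rule compact_ball_radius[OF K(1)])
    have "((\<lambda>T. elog (chord_number \<phi> x y \<eta> T (T + \<tau>) \<delta>) / ereal T) \<longlongrightarrow> ?h) at_top"
      if "x \<in> K" "y \<in> K" and \<tau>: "\<tau> \<ge> 5 * min_period \<phi> K" and "0 < \<delta>" "\<delta> < min separation_scale r / 2"
        "0 < \<eta>" "\<eta> < min separation_scale r / 2" for x y \<tau> \<delta> \<eta>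
    proof -
      have "\<tau> > 0"
        using \<tau> min_period_bounds(1)[OF K] by linarith
      moreover have "\<delta> < separation_scale" "\<eta> \<le> r"
        using that separation_scale_pos r(1) by linarith+
      ultimately have "((\<lambda>T. elog (chord_number \<phi> x y \<eta> T (T + \<tau>) \<delta>) / ereal T) \<longlongrightarrow>
          gurevic_entropy \<phi> K 1) at_top"
        using that r by (intro chord_number_tendsto_gurevic[OF K r(2)]) auto
      then show ?thesis
        by (simp add: h[OF K])
    qed
    moreover have "min separation_scale r > 0"
      using separation_scale_pos r(1) by simp
    ultimately show ?thesis
      by (intro exI[of _ "min separation_scale r"]) auto
  qed
  moreover have "chord_entropy \<phi> x y \<sigma> = ?h" if "\<sigma> > 0" for x y \<sigma>
    using chord_entropy_eq_gurevic[OF K1 _ that, of 1] by simp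
  ultimately show ?thesis
    using h by (intro exI[of _ ?h]) auto
qed

end
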